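(* Let $0<R<1$ and let $u\in C^\infty(\overline{B_1};\mathbb{S}^2)$ satisfy $-\Delta u=|\nabla u|^2u$ in $B_1$ and $u=g_R$ on $\partial B_1$. Then for all $\theta$ $$|u_r(1,\theta)|=R,\qquad u_r(1,\theta)\cdot u_\theta(1,\theta)=0.$$ Equivalently, $q(e^{i\theta})=0$ for all $\theta$.
   Context: $B_1$ is the open unit disk in $\mathbb{R}^2\cong\mathbb{C}$, with $z=x+iy=re^{i\theta}$, and $\mathbb{S}^2\subset\mathbb{R}^3$ is the unit sphere. Subscripts $r,\theta,x,y$ denote partial derivatives. The boundary datum is $g_R(e^{i\theta})=(R\cos\theta,R\sin\theta,\sqrt{1-R^2})$. The Hopf scalar of $u$ is $q(z)=u_z\cdot u_z$ on $\overline{B_1}$, where $u_z=\tfrac12(u_x-iu_y)$ and the dot product is extended complex bilinearly (not sesquilinearly) to $\mathbb{C}^3$. *)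

theory Defs
  imports "HOL-Analysis.Analysis"
begin

text \<open>
  Derivatives are Frechet derivatives relative to the set \<open>S\<close>. On a convex set with nonempty
  interior, such as the closed disk, these are unique also at boundary points, where they agree with
  the continuous extensions of the interior derivatives whenever such extensions exist.
  For \<open>S = cball 0 1\<close>, \<open>smooth_on\<close> therefore is smoothness up to the boundary: all partial
  derivatives exist in the interior and extend continuously to the closed disk.
\<close>

definition dir_deriv ::
  "'a::real_normed_vector set \<Rightarrow> 'a \<Rightarrow> ('a \<Rightarrow> 'b::real_normed_vector) \<Rightarrow> 'a \<Rightarrow> 'b"
  where "dir_deriv S v f z = frechet_derivative f (at z within S) v"

primrec Ck_on ::
  "nat \<Rightarrow> 'a::real_normed_vector set \<Rightarrow> ('a \<Rightarrow> 'b::real_normed_vector) \<Rightarrow> bool"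
  where
    "Ck_on 0 S f \<longleftrightarrow> continuous_on S f"
  | "Ck_on (Suc k) S f \<longleftrightarrow> f differentiable_on S \<and> (\<forall>v. Ck_on k S (dir_deriv S v f))"

definition smooth_on ::
  "'a::real_normed_vector set \<Rightarrow> ('a \<Rightarrow> 'b::real_normed_vector) \<Rightarrow> bool"
  where "smooth_on S f \<longleftrightarrow> (\<forall>k. Ck_on k S f)"

text \<open>The plane is \<open>complex\<close>; \<open>1\<close> and \<open>\<i>\<close> are the coordinate directions \<open>x\<close> and \<open>y\<close>.\<close>

definition deriv_x :: "(complex \<Rightarrow> real^3) \<Rightarrow> complex \<Rightarrow> real^3"
  where "deriv_x = dir_deriv (cball 0 1) 1"

definition deriv_y :: "(complex \<Rightarrow> real^3) \<Rightarrow> complex \<Rightarrow> real^3"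
  where "deriv_y = dir_deriv (cball 0 1) \<i>"

definition laplacian :: "(complex \<Rightarrow> real^3) \<Rightarrow> complex \<Rightarrow> real^3"
  where "laplacian u z = deriv_x (deriv_x u) z + deriv_y (deriv_y u) z"

definition grad_norm_sq :: "(complex \<Rightarrow> real^3) \<Rightarrow> complex \<Rightarrow> real"
  where "grad_norm_sq u z = (norm (deriv_x u z))\<^sup>2 + (norm (deriv_y u z))\<^sup>2"

text \<open>In polar coordinates the radius ranges over \<open>{0..1}\<close>, so \<open>deriv_r u 1 \<theta>\<close> is one-sided.\<close>

definition deriv_r :: "(complex \<Rightarrow> real^3) \<Rightarrow> real \<Rightarrow> real \<Rightarrow> real^3"
  where "deriv_r u r \<theta> = vector_derivative (\<lambda>s. u (rcis s \<theta>)) (at r within {0..1})"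

definition deriv_theta :: "(complex \<Rightarrow> real^3) \<Rightarrow> real \<Rightarrow> real \<Rightarrow> real^3"
  where "deriv_theta u r \<theta> = vector_derivative (\<lambda>t. u (rcis r t)) (at \<theta>)"

definition boundary_datum :: "real \<Rightarrow> real \<Rightarrow> real^3"
  where "boundary_datum R \<theta> = vector [R * cos \<theta>, R * sin \<theta>, sqrt (1 - R\<^sup>2)]"

definition deriv_z :: "(complex \<Rightarrow> real^3) \<Rightarrow> complex \<Rightarrow> complex^3"
  where "deriv_z u z =
    (\<chi> j. (complex_of_real (deriv_x u z $ j) - \<i> * complex_of_real (deriv_y u z $ j)) / 2)"

text \<open>Complex bilinear, unlike an inner product on \<open>complex^3\<close>.\<close>

definition bilinear_dot :: "complex^3 \<Rightarrow> complex^3 \<Rightarrow> complex"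
  where "bilinear_dot a b = (\<Sum>j\<in>UNIV. a $ j * b $ j)"

definition hopf :: "(complex \<Rightarrow> real^3) \<Rightarrow> complex \<Rightarrow> complex"
  where "hopf u z = bilinear_dot (deriv_z u z) (deriv_z u z)"

end

theory Submission
  imports Defs "HOL-Complex_Analysis.Cauchy_Integral_Formula"
begin

text \<open>
  The function \<open>F = 4 z\<^sup>2 q\<close> is holomorphic with \<open>F 0 = 0\<close>, and on the unit circle
  \<open>F = |u\<^sub>r|\<^sup>2 - R\<^sup>2 - 2 \<i> u\<^sub>r \<bullet> u\<^sub>\<theta>\<close>; hence \<open>F\<close> and \<open>F\<^sup>2\<close> have mean zero there.
  With \<open>J = u \<times> du\<close>, harmonicity makes the \<open>su(2)\<close>-connection \<open>(J + *J)/2\<close> flat, so it has a parallel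
  unit spinor \<open>\<phi>\<close> on the closed disk. The rotation \<open>\<theta>\<close> about the vertical axis lifts to spinors
  antiperiodically; seen in the frame rotating with the boundary datum, \<open>\<phi>\<close> therefore becomes a path
  \<open>\<chi>\<close> over \<open>[0, 2\<pi>]\<close> joining antipodal points of the sphere \<open>S\<^sup>3\<close>, and so has length at least \<open>\<pi>\<close>.
  On the other hand \<open>4 |\<chi>'|\<^sup>2 = 1 + |u\<^sub>r|\<^sup>2 - R\<^sup>2 = 1 + Re F\<close>, whence \<open>\<integral>|\<chi>'|\<^sup>2 = \<pi>/2\<close> and, by
  Cauchy-Schwarz, length at most \<open>\<pi>\<close>. Equality forces \<open>|\<chi>'| = 1/2\<close>, that is \<open>Re F = 0\<close> on the
  circle, and then the mean of \<open>F\<^sup>2\<close> gives \<open>Im F = 0\<close> as well.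
\<close>

section \<open>Curves and mixed partial derivatives\<close>

text \<open>The angle \<open>arccos (\<gamma> t \<bullet> \<gamma> a)\<close> goes from 0 to \<pi>
  and changes no faster than arc length.\<close>

lemma antipodal_path_length:
  fixes \<gamma> :: "real \<Rightarrow> 'v::real_inner"
  assumes ab: "a \<le> b"
    and deriv: "\<And>t. t \<in> {a..b} \<Longrightarrow> (\<gamma> has_vector_derivative \<gamma>' t) (at t within {a..b})"
    and unit: "\<And>t. t \<in> {a..b} \<Longrightarrow> norm (\<gamma> t) = 1"
    and cont: "continuous_on {a..b} (\<lambda>t. norm (\<gamma>' t))"
    and anti: "\<gamma> b = - \<gamma> a"
  shows "pi \<le> integral {a..b} (\<lambda>t. norm (\<gamma>' t))"
proof -
  define L where "L t = integral {a..t} (\<lambda>t. norm (\<gamma>' t))" for t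
  define c where "c t = \<gamma> t \<bullet> \<gamma> a" for t
  have ua: "\<gamma> a \<bullet> \<gamma> a = 1"
    using unit[of a] ab by (simp add: dot_square_norm)
  have perp: "\<gamma>' t \<bullet> \<gamma> t = 0" if t: "t \<in> {a<..<b}" for t
  proof -
    have d: "(\<gamma> has_vector_derivative \<gamma>' t) (at t)"
      using deriv[of t] t by (simp add: at_within_Icc_at)
    have "((\<lambda>s. \<gamma> s \<bullet> \<gamma> s) has_vector_derivative (\<gamma> t \<bullet> \<gamma>' t + \<gamma>' t \<bullet> \<gamma> t)) (at t)"
      by (rule bounded_bilinear.has_vector_derivative[OF bounded_bilinear_inner d d])
    moreover have "((\<lambda>s. \<gamma> s \<bullet> \<gamma> s) has_vector_derivative 0) (at t)"
    proof (rule has_vector_derivative_transform_within_open[where S="{a<..<b}"])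
      show "((\<lambda>s. 1) has_vector_derivative 0) (at t)" by simp
    qed (use t unit in \<open>auto simp: dot_square_norm\<close>)
    ultimately show ?thesis
      using vector_derivative_unique_at by (fastforce simp: inner_commute)
  qed
  have c1: "\<bar>c t\<bar> \<le> 1" if "t \<in> {a..b}" for t
    using Cauchy_Schwarz_ineq2[of "\<gamma> t" "\<gamma> a"] unit[OF that] unit[of a] ab
    by (simp add: c_def)
  have cd: "(c has_real_derivative \<gamma>' t \<bullet> \<gamma> a) (at t)" if t: "t \<in> {a<..<b}" for t
  proof -
    have d: "(\<gamma> has_vector_derivative \<gamma>' t) (at t)"
      using deriv[of t] t by (simp add: at_within_Icc_at)
    show ?thesis
      unfolding c_def has_real_derivative_iff_has_vector_derivative
      by (rule bounded_linear.has_vector_derivative[OF bounded_linear_inner_left d])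
  qed
  \<comment> \<open>Since \<open>\<gamma>' t\<close> is orthogonal to \<open>\<gamma> t\<close>,
    only the part \<open>?w\<close> of \<open>\<gamma> a\<close> orthogonal to
    \<open>\<gamma> t\<close> contributes, and its squared norm is
    \<open>1 - (c t)\<^sup>2\<close>.\<close>
  have cd_bound: "(\<gamma>' t \<bullet> \<gamma> a)\<^sup>2 \<le> (norm (\<gamma>' t))\<^sup>2 * (1 - (c t)\<^sup>2)" if t: "t \<in> {a<..<b}" for t
  proof -
    let ?w = "\<gamma> a - c t *\<^sub>R \<gamma> t"
    have ut: "\<gamma> t \<bullet> \<gamma> t = 1" using unit[of t] t by (simp add: dot_square_norm)
    have "\<gamma>' t \<bullet> ?w = \<gamma>' t \<bullet> \<gamma> a" using perp[OF t] by (simp add: inner_diff_right)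
    moreover have "?w \<bullet> ?w = 1 - (c t)\<^sup>2"
      using ut ua by (simp add: inner_diff_right inner_diff_left c_def inner_commute power2_eq_square)
    moreover have "(\<gamma>' t \<bullet> ?w)\<^sup>2 \<le> (\<gamma>' t \<bullet> \<gamma>' t) * (?w \<bullet> ?w)"
      by (rule Cauchy_Schwarz_ineq)
    ultimately show ?thesis by (simp add: power2_norm_eq_inner)
  qed
  \<comment> \<open>\<open>arccos\<close> is not differentiable at the end values 1 and -1 of
    \<open>c\<close>, so \<open>c\<close> is first scaled by \<open>k < 1\<close>; the bound \<pi>
    appears as \<open>k\<close> tends to 1.\<close>
  have main: "arccos (-k) - arccos k \<le> L b" if k: "0 < k" "k < 1" for k
  proof (cases "a = b")
    case True
    then have "\<gamma> a = 0" using anti by (simp add: eq_neg_iff_add_eq_0 flip: scaleR_2)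
    then show ?thesis using unit[of a] ab by simp
  next
    case False
    then have ab': "a < b" using ab by simp
    have kc: "\<bar>k * c t\<bar> < 1" if "t \<in> {a..b}" for t
    proof -
      have "\<bar>k * c t\<bar> \<le> k * 1" using c1[OF that] k by (simp add: abs_mult)
      then show ?thesis using k by simp
    qed
    have cont_c: "continuous_on {a..b} c"
      unfolding c_def
      by (intro continuous_intros)
        (meson continuous_on_eq_continuous_within deriv has_vector_derivative_continuous)
    have "norm (arccos (k * c b) - arccos (k * c a)) \<le> L b - L a"
    proof (rule differentiable_bound_general[OF ab'])
      show "continuous_on {a..b} (\<lambda>t. arccos (k * c t))"
        using kc by (intro continuous_intros cont_c) (auto simp: abs_less_iff less_imp_le minus_le_iff)
      show "continuous_on {a..b} L"
        unfolding L_def by (intro indefinite_integral_continuous_1 integrable_continuous_real cont)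
      fix t assume t: "a < t" "t < b"
      have kt: "\<bar>k * c t\<bar> < 1" using kc t by simp
      show "(L has_vector_derivative norm (\<gamma>' t)) (at t)"
        using integral_has_vector_derivative[OF cont, of t] t
        unfolding L_def by (simp add: at_within_Icc_at)
      have "((\<lambda>t. arccos (k * c t)) has_real_derivative
              inverse (- sqrt (1 - (k * c t)\<^sup>2)) * (k * (\<gamma>' t \<bullet> \<gamma> a))) (at t)"
        using cd[of t] t kt
        by (intro DERIV_chain2[where f=arccos] DERIV_arccos DERIV_cmult) (auto simp: abs_less_iff)
      then show "((\<lambda>t. arccos (k * c t)) has_vector_derivative
              inverse (- sqrt (1 - (k * c t)\<^sup>2)) * (k * (\<gamma>' t \<bullet> \<gamma> a))) (at t)"
        by (simp add: has_real_derivative_iff_has_vector_derivative)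
      have pos: "0 < 1 - (k * c t)\<^sup>2" using kt by (simp add: abs_square_less_1)
      \<comment> \<open>This amounts to \<open>k\<^sup>2 \<le> 1\<close>, so scaling by
        \<open>k\<close> does not spoil the speed bound.\<close>
      have "k\<^sup>2 * (1 - (c t)\<^sup>2) \<le> 1 - (k * c t)\<^sup>2"
        using k by (simp add: power_mult_distrib algebra_simps abs_square_le_1)
      then have "(k * (\<gamma>' t \<bullet> \<gamma> a))\<^sup>2 \<le> (norm (\<gamma>' t))\<^sup>2 * (1 - (k * c t)\<^sup>2)"
        using mult_left_mono[OF cd_bound[of t], of "k\<^sup>2"] t
          mult_left_mono[of "k\<^sup>2 * (1 - (c t)\<^sup>2)" "1 - (k * c t)\<^sup>2" "(norm (\<gamma>' t))\<^sup>2"]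
        by (simp add: power_mult_distrib algebra_simps)
      then have "\<bar>k * (\<gamma>' t \<bullet> \<gamma> a)\<bar> \<le> norm (\<gamma>' t) * sqrt (1 - (k * c t)\<^sup>2)"
        using real_sqrt_le_mono by (fastforce simp: real_sqrt_mult)
      then show "norm (inverse (- sqrt (1 - (k * c t)\<^sup>2)) * (k * (\<gamma>' t \<bullet> \<gamma> a))) \<le> norm (\<gamma>' t)"
        using pos by (simp add: abs_mult divide_simps)
    qed
    moreover have "c a = 1" "c b = -1" "L a = 0"
      using ua anti by (simp_all add: c_def L_def)
    ultimately show ?thesis by simp
  qed
  have "((\<lambda>k. arccos (-k) - arccos k) \<longlongrightarrow> arccos (-1) - arccos 1) (at 1 within {0..1})"
  proof -
    have "continuous_on {0..1::real} (\<lambda>k. arccos (-k) - arccos k)"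
      by (intro continuous_intros) auto
    then show ?thesis unfolding continuous_on_def by (rule bspec) simp
  qed
  moreover have "at (1::real) within {0..1} \<noteq> bot"
    by (simp add: at_within_Icc_at_left)
  moreover have "eventually (\<lambda>k::real. arccos (-k) - arccos k \<le> L b) (at 1 within {0..1})"
    unfolding eventually_at
    by (rule exI[of _ "1/2"]) (auto intro!: main simp: dist_real_def)
  ultimately have "arccos (-1) - arccos 1 \<le> L b"
    by (blast intro: tendsto_upperbound)
  then show ?thesis by (simp add: L_def)
qed

text \<open>Subscripts are read in order of differentiation: \<open>fxy\<close> is the y-derivative
  of \<open>fx\<close>. Continuity of \<open>fyx\<close> permits differentiation under the integral
  sign.\<close>

lemma mixed_partials_eq:
  fixes f fx fy fxx fxy fyx fyy :: "complex \<Rightarrow> 'b::banach"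
  assumes S: "open S" "z \<in> S"
    and f: "\<And>z. z \<in> S \<Longrightarrow> (f has_derivative (\<lambda>v. Re v *\<^sub>R fx z + Im v *\<^sub>R fy z)) (at z)"
    and fx: "\<And>z. z \<in> S \<Longrightarrow> (fx has_derivative (\<lambda>v. Re v *\<^sub>R fxx z + Im v *\<^sub>R fxy z)) (at z)"
    and fy: "\<And>z. z \<in> S \<Longrightarrow> (fy has_derivative (\<lambda>v. Re v *\<^sub>R fyx z + Im v *\<^sub>R fyy z)) (at z)"
    and cont: "continuous_on S fyx"
  shows "fxy z = fyx z"
proof -
  obtain d where d: "d > 0" "ball z d \<subseteq> S"
    using S openE by blast
  define a where "a = Re z"
  define b where "b = Im z"
  \<comment> \<open>With half the radius, offsets of at most \<open>e\<close> in one coordinate and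
    less than \<open>e\<close> in the other stay inside the ball of radius \<open>d\<close>.\<close>
  define e where "e = d / 2"
  have e: "e > 0" using d by (simp add: e_def)
  have inS: "Complex x y \<in> S" if "\<bar>x - a\<bar> \<le> e" "\<bar>y - b\<bar> < e" for x y
  proof -
    have "dist z (Complex x y) \<le> \<bar>x - a\<bar> + \<bar>y - b\<bar>"
      using cmod_le[of "Complex x y - z"]
      by (simp add: a_def b_def dist_norm norm_minus_commute)
    also have "\<dots> < d" using that by (simp add: e_def)
    finally show ?thesis using d by auto
  qed
  have dx: "((\<lambda>x. g (Complex x y)) has_vector_derivative gx) (at x within T)"
    if "(g has_derivative (\<lambda>v. Re v *\<^sub>R gx + Im v *\<^sub>R gy)) (at (Complex x y))"
    for g :: "complex \<Rightarrow> 'b" and gx gy x y T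
  proof -
    have "((\<lambda>x. Complex x y) has_derivative (\<lambda>h. complex_of_real h)) (at x within T)"
      unfolding Complex_eq by (auto intro!: derivative_eq_intros)
    from has_derivative_compose[OF this that] show ?thesis
      by (simp add: has_vector_derivative_def)
  qed
  have dy: "((\<lambda>y. g (Complex x y)) has_vector_derivative gy) (at y within T)"
    if "(g has_derivative (\<lambda>v. Re v *\<^sub>R gx + Im v *\<^sub>R gy)) (at (Complex x y))"
    for g :: "complex \<Rightarrow> 'b" and gx gy x y T
  proof -
    have "((\<lambda>y. Complex x y) has_derivative (\<lambda>h. \<i> * complex_of_real h)) (at y within T)"
      unfolding Complex_eq by (auto intro!: derivative_eq_intros)
    from has_derivative_compose[OF this that] show ?thesis
      by (simp add: has_vector_derivative_def)
  qed
  have contfy: "continuous_on S fy"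
    by (meson continuous_at_imp_continuous_on fy has_derivative_continuous)
  have contC: "continuous_on X (\<lambda>p. Complex (g p) (h p))"
    if "continuous_on X g" "continuous_on X h" for X :: "'x::topological_space set" and g h
    unfolding Complex_eq using that by (intro continuous_intros)
  text \<open>Differentiating \<open>f(x,y) = f(x,b) + \<integral>\<^sub>b\<^sup>y f\<^sub>y(x,t) dt\<close> first in \<open>x\<close> and then in \<open>y\<close>.\<close>
  have eq: "fx (Complex a y) = fx (Complex a b) + integral {b..y} (\<lambda>t. fyx (Complex a t))"
    if y: "b \<le> y" "y < b + e" for y
  proof -
    have "((\<lambda>x. integral (cbox b y) (\<lambda>t. fy (Complex x t))) has_vector_derivative
            integral (cbox b y) (\<lambda>t. fyx (Complex a t))) (at a within {a-e..a+e})"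
    proof (rule leibniz_rule_vector_derivative)
      fix x t assume xt: "x \<in> {a-e..a+e}" "t \<in> cbox b y"
      then have "Complex x t \<in> S" using y by (intro inS) auto
      then show "((\<lambda>x. fy (Complex x t)) has_vector_derivative fyx (Complex x t)) (at x within {a-e..a+e})"
        by (rule dx[OF fy])
    next
      fix x assume x: "x \<in> {a-e..a+e}"
      show "(\<lambda>t. fy (Complex x t)) integrable_on cbox b y"
        using x y by (intro integrable_continuous continuous_on_compose2[OF contfy] contC continuous_intros)
          (auto intro!: inS)
    next
      show "continuous_on ({a-e..a+e} \<times> cbox b y) (\<lambda>(x, t). fyx (Complex x t))"
        unfolding split_beta
        using y by (intro continuous_on_compose2[OF cont] contC continuous_intros) (auto intro!: inS)
    qed (use e in auto)
    moreover have "integral {b..y} (\<lambda>t. fy (Complex x t)) = f (Complex x y) - f (Complex x b)"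
      if x: "x \<in> {a-e..a+e}" for x
    proof (intro integral_unique fundamental_theorem_of_calculus)
      fix t assume "t \<in> {b..y}"
      then have "Complex x t \<in> S" using x y by (intro inS) auto
      then show "((\<lambda>t. f (Complex x t)) has_vector_derivative fy (Complex x t)) (at t within {b..y})"
        by (rule dy[OF f])
    qed (use y in auto)
    ultimately have "((\<lambda>x. f (Complex x y) - f (Complex x b)) has_vector_derivative
            integral (cbox b y) (\<lambda>t. fyx (Complex a t))) (at a within {a-e..a+e})"
      using e by (auto elim!: has_vector_derivative_transform[rotated 2])
    moreover have "((\<lambda>x. f (Complex x y) - f (Complex x b)) has_vector_derivative
            fx (Complex a y) - fx (Complex a b)) (at a within {a-e..a+e})"
      using e y by (intro derivative_intros dx[OF f] inS) auto
    ultimately have "integral {b..y} (\<lambda>t. fyx (Complex a t)) = fx (Complex a y) - fx (Complex a b)"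
      using e by (intro vector_derivative_unique_within_closed_interval[of "a-e" "a+e" a]) auto
    then show ?thesis by simp
  qed
  \<comment> \<open>The formula \<open>eq\<close> covers only \<open>y \<ge> b\<close>, so the two
    values are compared as one-sided derivatives at \<open>b\<close>, which are still
    unique.\<close>
  have "((\<lambda>y. fx (Complex a b) + integral {b..y} (\<lambda>t. fyx (Complex a t))) has_vector_derivative
           0 + fyx (Complex a b)) (at b within {b..b+e/2})"
    using e by (intro derivative_intros integral_has_vector_derivative
        continuous_on_compose2[OF cont] contC continuous_intros) (auto intro!: inS)
  then have "((\<lambda>y. fx (Complex a y)) has_vector_derivative fyx (Complex a b)) (at b within {b..b+e/2})"
    using e by (auto elim!: has_vector_derivative_transform[rotated 2] intro!: eq)
  moreover have "((\<lambda>y. fx (Complex a y)) has_vector_derivative fxy (Complex a b)) (at b within {b..b+e/2})"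
    using e by (intro dy[OF fx] inS) auto
  ultimately have "fxy (Complex a b) = fyx (Complex a b)"
    using vector_derivative_unique_within_closed_interval[of b "b+e/2" b] e by auto
  then show ?thesis by (simp add: a_def b_def)
qed

section \<open>Linear differential equations and flat transport\<close>

text \<open>Each term of an exponential series differentiates to \<open>D\<close> times its
  predecessor; this drives the inductions for the factorial bounds below.\<close>

lemma has_vector_derivative_exp_term:
  fixes x :: real
  shows "((\<lambda>x. M * (D * x) ^ Suc n / fact (Suc n)) has_vector_derivative D * (M * (D * x) ^ n / fact n))
    (at x within S)"
proof -
  have "((\<lambda>x. (D * x) ^ Suc n) has_real_derivative (1 + real n) * (D * (D * x) ^ n)) (at x within S)"
    by (rule DERIV_power_Suc) (auto intro!: derivative_eq_intros)
  then have "((\<lambda>x. M * (D * x) ^ Suc n / fact (Suc n)) has_real_derivative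
      M * ((1 + real n) * (D * (D * x) ^ n)) / fact (Suc n)) (at x within S)"
    by (intro DERIV_cdivide DERIV_cmult)
  moreover have "M * ((1 + real n) * (D * y)) / fact (Suc n) = D * (M * y / fact n)" for y
    unfolding fact_Suc by (simp add: field_simps del: of_nat_Suc) (simp add: algebra_simps)?
  ultimately show ?thesis
    by (simp only: has_real_derivative_iff_has_vector_derivative)
qed

text \<open>The hypothesis \<open>gronwall\<close> bounds \<open>E'\<close> at one parameter by a
  bound on \<open>E\<close> over all parameters, which admits integral operators in
  \<open>p\<close>. Feeding each bound into the next gives \<open>M * (D * r) ^ n / fact n\<close>,
  which tends to 0.\<close>

lemma gronwall_zero:
  fixes E :: "real \<Rightarrow> 'p \<Rightarrow> 'v::real_normed_vector"
  assumes init: "\<And>p. p \<in> K \<Longrightarrow> E 0 p = 0"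
    and deriv: "\<And>r p. r \<in> {0..1} \<Longrightarrow> p \<in> K \<Longrightarrow>
      ((\<lambda>r. E r p) has_vector_derivative E' r p) (at r within {0..1})"
    and bounded: "\<And>r p. r \<in> {0..1} \<Longrightarrow> p \<in> K \<Longrightarrow> norm (E r p) \<le> M"
    and gronwall: "\<And>r p m. r \<in> {0..1} \<Longrightarrow> p \<in> K \<Longrightarrow> (\<And>p. p \<in> K \<Longrightarrow> norm (E r p) \<le> m) \<Longrightarrow>
      norm (E' r p) \<le> D * m"
    and r: "r \<in> {0..1}" and p: "p \<in> K"
  shows "E r p = 0"
proof -
  have bound: "norm (E r p) \<le> M * (D * r) ^ n / fact n" if "r \<in> {0..1}" "p \<in> K" for n r p
    using that
  proof (induction n arbitrary: r p)
    case 0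
    then show ?case using bounded by simp
  next
    case (Suc n)
    show ?case
    proof (cases "r = 0")
      case True
      then show ?thesis using init Suc.prems by simp
    next
      case False
      then have r: "0 < r" "r \<le> 1" using Suc.prems by auto
      let ?\<phi> = "\<lambda>r. M * (D * r) ^ Suc n / fact (Suc n)"
      have "norm (E r p - E 0 p) \<le> ?\<phi> r - ?\<phi> 0"
      proof (rule differentiable_bound_general[OF \<open>0 < r\<close>])
        have "continuous_on {0..1} (\<lambda>r. E r p)"
          using deriv[OF _ \<open>p \<in> K\<close>] by (rule continuous_on_vector_derivative)
        then show "continuous_on {0..r} (\<lambda>r. E r p)"
          by (rule continuous_on_subset) (use r in auto)
        show "continuous_on {0..r} ?\<phi>"
          by (intro continuous_intros) auto
        fix x assume x: "0 < x" "x < r"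
        show "((\<lambda>r. E r p) has_vector_derivative E' x p) (at x)"
          using deriv[of x p] x r Suc.prems by (simp add: at_within_Icc_at)
        show "(?\<phi> has_vector_derivative D * (M * (D * x) ^ n / fact n)) (at x)"
          by (rule has_vector_derivative_exp_term)
        show "norm (E' x p) \<le> D * (M * (D * x) ^ n / fact n)"
          using x r Suc.prems by (intro gronwall Suc.IH) auto
      qed
      then show ?thesis using init Suc.prems by simp
    qed
  qed
  have "(\<lambda>n. M * (inverse (fact n) * (D * r) ^ n)) \<longlonglongrightarrow> M * 0"
    by (intro tendsto_mult tendsto_const summable_LIMSEQ_zero summable_exp)
  then have "norm (E r p) \<le> M * 0"
    using bound[OF r p] by (intro LIMSEQ_le_const) (auto simp: divide_simps)
  then show ?thesis by simp
qed

text \<open>Picard iteration written as a series: \<open>P n\<close> is bounded by a constant times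
  \<open>(C * r) ^ n / fact n\<close>, so the series and its termwise derivative converge uniformly.
  This yields the solution together with its joint continuity.\<close>

lemma linear_ode_with_parameter:
  fixes A :: "real \<Rightarrow> 'p::metric_space \<Rightarrow> 'a::real_normed_vector" and v0 :: "'v::euclidean_space"
    and act :: "'a \<Rightarrow> 'v \<Rightarrow> 'v"
  assumes act: "bounded_bilinear act" and K: "compact K"
    and A: "continuous_on ({0..1} \<times> K) (\<lambda>(r, p). A r p)"
  obtains \<psi> where "continuous_on ({0..1} \<times> K) (\<lambda>(r, p). \<psi> r p)"
    and "\<And>p. p \<in> K \<Longrightarrow> \<psi> 0 p = v0"
    and "\<And>r p. r \<in> {0..1} \<Longrightarrow> p \<in> K \<Longrightarrow>
      ((\<lambda>r. \<psi> r p) has_vector_derivative act (A r p) (\<psi> r p)) (at r within {0..1})"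
proof -
  interpret act: bounded_bilinear act by (rule act)
  obtain C where C: "C > 0" "\<And>r p v. r \<in> {0..1} \<Longrightarrow> p \<in> K \<Longrightarrow> norm (act (A r p) v) \<le> C * norm v"
  proof -
    have "compact ((\<lambda>(r, p). A r p) ` ({0..1} \<times> K))"
      by (intro compact_continuous_image A compact_Times K) auto
    then obtain a where a: "\<And>r p. r \<in> {0..1} \<Longrightarrow> p \<in> K \<Longrightarrow> norm (A r p) \<le> a"
      by (fastforce dest!: compact_imp_bounded simp: bounded_iff)
    obtain k where k: "k > 0" "\<And>x y. norm (act x y) \<le> norm x * norm y * k"
      using act.pos_bounded by blast
    show thesis
    proof
      \<comment> \<open>The maximum with 1 keeps \<open>C\<close> positive even where
        \<open>A\<close> vanishes, since \<open>e / C\<close> is formed later.\<close>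
      show "(0::real) < max 1 (\<bar>a\<bar> * k)" by simp
      fix r :: real and p v assume "r \<in> {0..1}" "p \<in> K"
      then have "norm (act (A r p) v) \<le> \<bar>a\<bar> * norm v * k"
        using a[of r p] k by (intro order_trans[OF k(2)] mult_right_mono) auto
      also have "\<dots> = \<bar>a\<bar> * k * norm v" by simp
      also have "\<dots> \<le> max 1 (\<bar>a\<bar> * k) * norm v"
        by (intro mult_right_mono) auto
      finally show "norm (act (A r p) v) \<le> max 1 (\<bar>a\<bar> * k) * norm v" .
    qed
  qed
  define P where "P = rec_nat (\<lambda>r p. v0) (\<lambda>n P r p. integral {0..r} (\<lambda>s. act (A s p) (P s p)))"
  have P0: "P 0 = (\<lambda>r p. v0)"
    and PS: "P (Suc n) = (\<lambda>r p. integral {0..r} (\<lambda>s. act (A s p) (P n s p)))" for n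
    by (simp_all add: P_def)
  have cont: "continuous_on ({0..1} \<times> K) (\<lambda>(r, p). P n r p)" for n
  proof (induction n)
    case 0
    show ?case by (simp add: P0 split_beta)
  next
    case (Suc n)
    have c: "continuous_on ({0..1} \<times> K) (\<lambda>x. act (A (fst x) (snd x)) (P n (fst x) (snd x)))"
      using A Suc by (intro act.continuous_on) (auto simp: split_beta)
    \<comment> \<open>Substituting \<open>s = r * \<sigma>\<close> moves the variable endpoint
      \<open>r\<close> into the integrand, so continuity of integrals over a fixed interval
      applies.\<close>
    have "continuous_on ({0..1} \<times> K)
        (\<lambda>x. integral (cbox 0 1) (\<lambda>\<sigma>. fst x *\<^sub>R act (A (fst x * \<sigma>) (snd x)) (P n (fst x * \<sigma>) (snd x))))"
    proof (rule integral_continuous_on_param)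
      show "continuous_on (({0..1} \<times> K) \<times> cbox 0 1)
        (\<lambda>(x, \<sigma>). fst x *\<^sub>R act (A (fst x * \<sigma>) (snd x)) (P n (fst x * \<sigma>) (snd x)))"
        unfolding split_beta
      proof (intro continuous_intros)
        show "continuous_on (({0..1} \<times> K) \<times> cbox 0 1)
          (\<lambda>y. act (A (fst (fst y) * snd y) (snd (fst y))) (P n (fst (fst y) * snd y) (snd (fst y))))"
          by (rule continuous_on_compose2[OF c, where f="\<lambda>y. (fst (fst y) * snd y, snd (fst y))", simplified])
            (auto intro!: continuous_intros mult_le_one)
      qed
    qed
    moreover have "integral (cbox 0 1) (\<lambda>\<sigma>. r *\<^sub>R act (A (r * \<sigma>) p) (P n (r * \<sigma>) p)) = P (Suc n) r p"
      if "r \<in> {0..1}" "p \<in> K" for r p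
    proof -
      have "continuous_on {0..r} (\<lambda>s. act (A s p) (P n s p))"
        using that by (intro continuous_on_compose2[OF c, where f="\<lambda>s. (s, p)", simplified])
           (auto intro!: continuous_intros)
      then have "((\<lambda>\<sigma>. r *\<^sub>R act (A (r * \<sigma>) p) (P n (r * \<sigma>) p)) has_integral
          integral {r * 0..r * 1} (\<lambda>s. act (A s p) (P n s p))) {0..1}"
        using that has_integral_substitution[where c=0 and d=r and g="\<lambda>\<sigma>. r * \<sigma>" and g'="\<lambda>_. r"
            and a=0 and b=1 and f="\<lambda>s. act (A s p) (P n s p)"]
        by (force intro!: derivative_eq_intros simp: mult_left_le image_subset_iff)
      from integral_unique[OF this] show ?thesis
        by (simp only: PS box_real mult_zero_right mult_1_right)
    qed
    ultimately show ?case
      by (auto simp: split_beta elim!: continuous_on_eq)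
  qed
  have cont_p: "continuous_on {0..1} (\<lambda>r. P n r p)" "continuous_on {0..1} (\<lambda>r. A r p)"
    if "p \<in> K" for n p
    using that continuous_on_compose2[OF cont[of n], of "{0..1}" "\<lambda>r. (r, p)"]
      continuous_on_compose2[OF A, of "{0..1}" "\<lambda>r. (r, p)"]
    by (auto simp: continuous_on_Pair)
  have P_deriv: "((\<lambda>r. P (Suc n) r p) has_vector_derivative act (A r p) (P n r p)) (at r within {0..1})"
    if "r \<in> {0..1}" "p \<in> K" for n r p
    unfolding PS using that
    by (intro integral_has_vector_derivative act.continuous_on cont_p) auto
  have bound: "norm (P n r p) \<le> norm v0 * ((C * r) ^ n / fact n)" if "r \<in> {0..1}" "p \<in> K" for n r p
    using that
  proof (induction n arbitrary: r)
    case 0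
    then show ?case by (simp add: P0)
  next
    case (Suc n)
    let ?I = "\<lambda>r. norm v0 * ((C * r) ^ Suc n / fact (Suc n))"
    have "norm (P (Suc n) r p) \<le> integral {0..r} (\<lambda>s. C * (norm v0 * ((C * s) ^ n / fact n)))"
      unfolding PS
    proof (rule integral_norm_bound_integral)
      show "(\<lambda>s. act (A s p) (P n s p)) integrable_on {0..r}"
        using Suc.prems by (intro integrable_continuous_real act.continuous_on
            continuous_on_subset[OF cont_p(1)] continuous_on_subset[OF cont_p(2)]) auto
      show "(\<lambda>s. C * (norm v0 * ((C * s) ^ n / fact n))) integrable_on {0..r}"
        by (intro integrable_continuous_real continuous_intros) auto
      fix s assume "s \<in> {0..r}"
      then have s: "s \<in> {0..1}" using Suc.prems by auto
      show "norm (act (A s p) (P n s p)) \<le> C * (norm v0 * ((C * s) ^ n / fact n))"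
        using C(1) by (intro order_trans[OF C(2)[OF s \<open>p \<in> K\<close>]] mult_left_mono Suc.IH s Suc.prems) auto
    qed
    also have "\<dots> = ?I r - ?I 0"
    proof (intro integral_unique fundamental_theorem_of_calculus)
      fix x :: real
      show "(?I has_vector_derivative C * (norm v0 * ((C * x) ^ n / fact n))) (at x within {0..r})"
        using has_vector_derivative_exp_term[of "norm v0" C n x "{0..r}"]
        by (simp only: times_divide_eq_right)
    qed (use Suc.prems in auto)
    finally show ?case by simp
  qed
  define \<psi> where "\<psi> r p = (\<Sum>n. P n r p)" for r p
  have ulim: "uniform_limit ({0..1} \<times> K) (\<lambda>n x. \<Sum>i<n. P i (fst x) (snd x)) (\<lambda>x. \<psi> (fst x) (snd x)) sequentially"
    unfolding \<psi>_def
  proof (rule Weierstrass_m_test)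
    fix n and x :: "real \<times> 'p" assume "x \<in> {0..1} \<times> K"
    then have x: "fst x \<in> {0..1}" "snd x \<in> K" by auto
    have "(C * fst x) ^ n \<le> C ^ n"
      using C(1) x by (intro power_mono) auto
    then show "norm (P n (fst x) (snd x)) \<le> norm v0 * (inverse (fact n) * C ^ n)"
      by (intro order_trans[OF bound[OF x]] mult_left_mono) (auto simp: divide_simps)
  next
    show "summable (\<lambda>n. norm v0 * (inverse (fact n) * C ^ n))"
      by (intro summable_mult summable_exp)
  qed
  have cont_\<psi>: "continuous_on ({0..1} \<times> K) (\<lambda>x. \<psi> (fst x) (snd x))"
    using cont by (intro uniform_limit_theorem[OF _ ulim] always_eventually allI continuous_intros)
       (auto simp: split_beta)
  have psums: "(\<lambda>n. P n r p) sums \<psi> r p" if "r \<in> {0..1}" "p \<in> K" for r p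
    using tendsto_uniform_limitI[OF ulim, of "(r, p)"] that by (simp add: sums_def)
  have init: "\<psi> 0 p = v0" if "p \<in> K" for p
  proof -
    have "P n 0 p = (if n = 0 then v0 else 0)" for n
      by (cases n) (auto simp: P0 PS)
    then have "(\<lambda>n. P n 0 p) sums v0"
      using sums_single[of 0 "\<lambda>_. v0"] by simp
    then show ?thesis using psums[of 0 p] that sums_unique2 by auto
  qed
  have deriv: "((\<lambda>r. \<psi> r p) has_vector_derivative act (A r p) (\<psi> r p)) (at r within {0..1})"
    if rp: "r \<in> {0..1}" "p \<in> K" for r p
  proof -
    \<comment> \<open>The derivative of \<open>P n\<close>: zero for the constant start, otherwise
      \<open>act\<close> applied to the previous term. This shift pairs partial sums of
      \<open>f'\<close> up to \<open>Suc n\<close> with partial sums of \<open>P\<close> up to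
      \<open>n\<close>.\<close>
    define f' where "f' n r = (case n of 0 \<Rightarrow> 0 | Suc m \<Rightarrow> act (A r p) (P m r p))" for n r
    have sum_f': "(\<Sum>i<Suc n. f' i r) = act (A r p) (\<Sum>i<n. P i r p)" for n r
      unfolding sum.lessThan_Suc_shift by (simp add: f'_def act.sum_right)
    have "\<exists>g. \<forall>x\<in>{0..1}. (\<lambda>n. P n x p) sums g x \<and>
        (g has_derivative (\<lambda>h. h *\<^sub>R act (A x p) (\<psi> x p))) (at x within {0..1})"
    proof (rule has_derivative_series)
      show "((\<lambda>r. P n r p) has_derivative (\<lambda>h. h *\<^sub>R f' n x)) (at x within {0..1})"
        if "x \<in> {0..1}" for n x
        using P_deriv[OF that \<open>p \<in> K\<close>]
        by (cases n) (auto simp: f'_def P0 has_vector_derivative_def)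
      fix e :: real assume "e > 0"
      then have "\<forall>\<^sub>F n in sequentially. \<forall>x\<in>{0..1} \<times> K.
          dist (\<Sum>i<n. P i (fst x) (snd x)) (\<psi> (fst x) (snd x)) < e / C"
        using ulim C(1) by (auto simp: uniform_limit_iff)
      then have "\<forall>\<^sub>F n in sequentially. \<forall>x\<in>{0..1}. \<forall>h.
          norm ((\<Sum>i<Suc n. h *\<^sub>R f' i x) - h *\<^sub>R act (A x p) (\<psi> x p)) \<le> e * norm h"
      proof eventually_elim
        case (elim n)
        show ?case
        proof (intro ballI allI)
          fix x h :: real assume x: "x \<in> {0..1}"
          have "norm ((\<Sum>i<Suc n. h *\<^sub>R f' i x) - h *\<^sub>R act (A x p) (\<psi> x p))
              = \<bar>h\<bar> * norm (act (A x p) ((\<Sum>i<n. P i x p) - \<psi> x p))"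
            unfolding scaleR_sum_right[symmetric] sum_f' 
            by (simp add: act.diff_right flip: scaleR_diff_right)
          also have "\<dots> \<le> \<bar>h\<bar> * (C * (e / C))"
            using elim[rule_format, of "(x, p)"] x \<open>p \<in> K\<close> C(1)
            by (intro mult_left_mono order_trans[OF C(2)[OF x \<open>p \<in> K\<close>]]) (auto simp: dist_norm)
          finally show "norm ((\<Sum>i<Suc n. h *\<^sub>R f' i x) - h *\<^sub>R act (A x p) (\<psi> x p)) \<le> e * norm h"
            using C(1) by (simp add: mult.commute)
        qed
      qed
      then show "\<forall>\<^sub>F n in sequentially. \<forall>x\<in>{0..1}. \<forall>h.
          norm ((\<Sum>i<n. h *\<^sub>R f' i x) - h *\<^sub>R act (A x p) (\<psi> x p)) \<le> e * norm h"
        by (subst (asm) eventually_sequentially_Suc)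
    qed (use psums[OF rp] rp in auto)
    then obtain g where g: "\<And>x. x \<in> {0..1} \<Longrightarrow> (\<lambda>n. P n x p) sums g x"
      "\<And>x. x \<in> {0..1} \<Longrightarrow> (g has_vector_derivative act (A x p) (\<psi> x p)) (at x within {0..1})"
      unfolding has_vector_derivative_def by blast
    have "\<psi> x p = g x" if "x \<in> {0..1}" for x
      using g(1)[OF that] psums[OF that \<open>p \<in> K\<close>] sums_unique2 by blast
    then show ?thesis
      by (rule has_vector_derivative_transform[OF rp(1) _ g(2)[OF rp(1)]])
  qed
  show thesis
    using that[of \<psi>] cont_\<psi> init deriv by (simp add: split_beta)
qed


text \<open>\<open>A dr + B dt\<close> is a connection on a rectangle, and \<open>flat\<close> says
  that its curvature vanishes. Of \<open>\<psi>\<close> only continuity and the radial equation are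
  given, so the equation in \<open>t\<close> is reached in integrated form.\<close>

lemma flat_transport:
  fixes A B A' B' :: "real \<Rightarrow> real \<Rightarrow> 'a::real_normed_vector"
    and act :: "'a \<Rightarrow> 'v \<Rightarrow> 'v::banach" and \<psi> :: "real \<Rightarrow> real \<Rightarrow> 'v"
  assumes act: "bounded_bilinear act" and T: "0 \<le> T"
    and contA: "continuous_on ({0..1} \<times> {0..T}) (\<lambda>(r, t). A r t)"
    and contB: "continuous_on ({0..1} \<times> {0..T}) (\<lambda>(r, t). B r t)"
    and contA': "continuous_on ({0..1} \<times> {0..T}) (\<lambda>(r, t). A' r t)"
    and contB': "continuous_on ({0..1} \<times> {0..T}) (\<lambda>(r, t). B' r t)"
    and A': "\<And>r t. r \<in> {0..1} \<Longrightarrow> t \<in> {0..T} \<Longrightarrow>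
      ((\<lambda>t. A r t) has_vector_derivative A' r t) (at t within {0..T})"
    and B': "\<And>r t. r \<in> {0..1} \<Longrightarrow> t \<in> {0..T} \<Longrightarrow>
      ((\<lambda>r. B r t) has_vector_derivative B' r t) (at r within {0..1})"
    and flat: "\<And>r t v. r \<in> {0..1} \<Longrightarrow> t \<in> {0..T} \<Longrightarrow>
      act (B' r t) v + act (B r t) (act (A r t) v) = act (A' r t) v + act (A r t) (act (B r t) v)"
    and B0: "\<And>t. t \<in> {0..T} \<Longrightarrow> B 0 t = 0"
    and cont: "continuous_on ({0..1} \<times> {0..T}) (\<lambda>(r, t). \<psi> r t)"
    and init: "\<And>t. t \<in> {0..T} \<Longrightarrow> \<psi> 0 t = c"
    and radial: "\<And>r t. r \<in> {0..1} \<Longrightarrow> t \<in> {0..T} \<Longrightarrow>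
      ((\<lambda>r. \<psi> r t) has_vector_derivative act (A r t) (\<psi> r t)) (at r within {0..1})"
    and r: "r \<in> {0..1}" and t: "t \<in> {0..T}"
  shows "((\<lambda>t. \<psi> r t) has_vector_derivative act (B r t) (\<psi> r t)) (at t within {0..T})"
proof -
  interpret act: bounded_bilinear act by (rule act)
  let ?R = "{0..1::real} \<times> {0..T}"
  have sec: "continuous_on {0..T} (\<lambda>t. f r t)" if "continuous_on ?R (\<lambda>(r, t). f r t)" "r \<in> {0..1}"
    for f :: "real \<Rightarrow> real \<Rightarrow> 'x::topological_space" and r
  proof -
    have "continuous_on {0..T} (\<lambda>t. case (r, t) of (r, t) \<Rightarrow> f r t)"
      by (rule continuous_on_compose2[OF that(1)])
        (use that(2) in \<open>auto intro: continuous_on_Pair[OF continuous_on_const continuous_on_id]\<close>)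
    then show ?thesis by simp
  qed
  have cont_act: "continuous_on ?R (\<lambda>(r, t). act (f r t) (g r t))"
    if "continuous_on ?R (\<lambda>(r, t). f r t)" "continuous_on ?R (\<lambda>(r, t). g r t)" for f g
    using that unfolding split_beta by (rule act.continuous_on)
  have bounded: "\<exists>a>0. \<forall>r\<in>{0..1}. \<forall>t\<in>{0..T}. norm (f r t) \<le> a"
    if f: "continuous_on ?R (\<lambda>(r, t). f r t)" for f :: "real \<Rightarrow> real \<Rightarrow> 'x::real_normed_vector"
  proof -
    have "compact ((\<lambda>(r, t). f r t) ` ?R)"
      by (intro compact_continuous_image f compact_Times) auto
    then show ?thesis
      by (fastforce dest!: compact_imp_bounded simp: bounded_pos)
  qed
  \<comment> \<open>\<open>\<Phi>\<close> is the right-hand side of the integrated equation in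
    \<open>t\<close>. The defect \<open>E\<close> is shown to vanish because it solves a linear
    equation in \<open>r\<close>.\<close>
  define I where "I r t = integral {0..t} (\<lambda>s. act (B r s) (\<psi> r s))" for r t
  define \<Phi> where "\<Phi> r t = \<psi> r 0 + I r t" for r t
  define E where "E r t = \<psi> r t - \<Phi> r t" for r t
  define E' where "E' r t = act (A r t) (E r t) - integral {0..t} (\<lambda>s. act (A' r s) (E r s))" for r t
  have z: "0 \<in> {0..T}" using T by simp
  have I_t: "((\<lambda>t. I r t) has_vector_derivative act (B r t) (\<psi> r t)) (at t within {0..T})"
    if "r \<in> {0..1}" "t \<in> {0..T}" for r t
    unfolding I_def using that
    by (intro integral_has_vector_derivative sec[OF cont_act] contB cont)
  have \<Phi>_t: "((\<lambda>t. \<Phi> r t) has_vector_derivative act (B r t) (\<psi> r t)) (at t within {0..T})"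
    if "r \<in> {0..1}" "t \<in> {0..T}" for r t
    unfolding \<Phi>_def using has_vector_derivative_add[OF has_vector_derivative_const I_t[OF that]] by simp
  have \<Phi>_sec: "continuous_on {0..T} (\<lambda>t. \<Phi> r t)" if "r \<in> {0..1}" for r
    by (rule continuous_on_vector_derivative[OF \<Phi>_t[OF that]])
  have E_sec: "continuous_on {0..T} (\<lambda>t. E r t)" if "r \<in> {0..1}" for r
    unfolding E_def by (intro continuous_on_diff sec[OF cont] \<Phi>_sec that)
  have E_r: "((\<lambda>r. E r t) has_vector_derivative E' r t) (at r within {0..1})"
    if r: "r \<in> {0..1}" and t: "t \<in> {0..T}" for r t
  proof -
    let ?g = "\<lambda>r s. act (B' r s) (\<psi> r s) + act (B r s) (act (A r s) (\<psi> r s))"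
    have sub: "{0..t} \<subseteq> {0..T}" using t by auto
    have dI: "((\<lambda>r. integral (cbox 0 t) (\<lambda>s. act (B r s) (\<psi> r s))) has_vector_derivative
        integral (cbox 0 t) (?g r)) (at r within {0..1})"
    proof (rule leibniz_rule_vector_derivative)
      fix x s assume xs: "x \<in> {0..1::real}" "s \<in> cbox 0 t"
      then have "s \<in> {0..T}" using t by auto
      then show "((\<lambda>r. act (B r s) (\<psi> r s)) has_vector_derivative ?g x s) (at x within {0..1})"
        using act.has_vector_derivative[OF B'[OF xs(1)] radial[OF xs(1)]]
        by (simp add: add.commute)
    next
      fix x assume "x \<in> {0..1::real}"
      then show "(\<lambda>s. act (B x s) (\<psi> x s)) integrable_on cbox 0 t"
        by (intro integrable_continuous continuous_on_subset[OF sec[OF cont_act[OF contB cont]]])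
          (use sub in auto)
    next
      have "continuous_on ?R (\<lambda>(r, s). ?g r s)"
        using cont_act[OF contB' cont] cont_act[OF contB cont_act[OF contA cont]]
        unfolding split_beta by (rule continuous_on_add)
      then show "continuous_on ({0..1} \<times> cbox 0 t) (\<lambda>(r, s). ?g r s)"
        by (rule continuous_on_subset) (use sub in auto)
    qed (use r in auto)
    \<comment> \<open>Flatness trades the r-derivative of \<open>B \<psi>\<close> for terms that
      are, up to the defect, the t-derivative of \<open>A \<Phi>\<close>; integrating leaves
      boundary terms and an integral of \<open>A' E\<close>.\<close>
    have eq: "integral (cbox 0 t) (?g r) =
        integral {0..t} (\<lambda>s. act (A' r s) (\<psi> r s) + act (A r s) (act (B r s) (\<psi> r s)))"
      unfolding box_real by (intro integral_cong flat r) (use sub in auto)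
    moreover have h1: "((\<lambda>s. act (A' r s) (\<Phi> r s) + act (A r s) (act (B r s) (\<psi> r s))) has_integral
        act (A r t) (\<Phi> r t) - act (A r 0) (\<Phi> r 0)) {0..t}"
    proof (rule fundamental_theorem_of_calculus)
      fix s assume "s \<in> {0..t}"
      then have s: "s \<in> {0..T}" using sub by auto
      have "((\<lambda>s. act (A r s) (\<Phi> r s)) has_vector_derivative
          act (A r s) (act (B r s) (\<psi> r s)) + act (A' r s) (\<Phi> r s)) (at s within {0..T})"
        by (rule act.has_vector_derivative[OF A'[OF r s] \<Phi>_t[OF r s]])
      then show "((\<lambda>s. act (A r s) (\<Phi> r s)) has_vector_derivative
          act (A' r s) (\<Phi> r s) + act (A r s) (act (B r s) (\<psi> r s))) (at s within {0..t})"
        using sub by (simp add: add.commute has_vector_derivative_within_subset)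
    qed (use t in auto)
    moreover have h2: "((\<lambda>s. act (A' r s) (E r s)) has_integral integral {0..t} (\<lambda>s. act (A' r s) (E r s))) {0..t}"
      by (intro integrable_integral integrable_continuous_real
          continuous_on_subset[OF act.continuous_on[OF sec[OF contA' r] E_sec[OF r]] sub])
    ultimately have "integral (cbox 0 t) (?g r) =
        act (A r t) (\<Phi> r t) - act (A r 0) (\<Phi> r 0) + integral {0..t} (\<lambda>s. act (A' r s) (E r s))"
      using integral_unique[OF has_integral_add[OF h1 h2]] eq by (simp add: E_def act.diff_right add.commute)
    moreover have "((\<lambda>r. E r t) has_vector_derivative
        act (A r t) (\<psi> r t) - (act (A r 0) (\<psi> r 0) + integral (cbox 0 t) (?g r))) (at r within {0..1})"
      unfolding E_def \<Phi>_def I_def box_real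
      by (rule has_vector_derivative_diff[OF radial[OF r t] has_vector_derivative_add[OF radial[OF r z] dI[unfolded box_real]]])
    moreover have "\<Phi> r 0 = \<psi> r 0" by (simp add: \<Phi>_def I_def)
    ultimately show ?thesis by (simp add: E'_def E_def act.diff_right algebra_simps)
  qed
  obtain k where k: "k > 0" "\<And>x y. norm (act x y) \<le> norm x * norm y * k"
    using act.pos_bounded by blast
  obtain a where a: "a > 0" "\<And>r t. r \<in> {0..1} \<Longrightarrow> t \<in> {0..T} \<Longrightarrow> norm (A r t) \<le> a"
    using bounded[OF contA] by blast
  obtain a' where a': "a' > 0" "\<And>r t. r \<in> {0..1} \<Longrightarrow> t \<in> {0..T} \<Longrightarrow> norm (A' r t) \<le> a'"
    using bounded[OF contA'] by blast
  obtain p where p: "p > 0" "\<And>r t. r \<in> {0..1} \<Longrightarrow> t \<in> {0..T} \<Longrightarrow> norm (\<psi> r t) \<le> p"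
    using bounded[OF cont] by blast
  obtain q where q: "q > 0" "\<And>r t. r \<in> {0..1} \<Longrightarrow> t \<in> {0..T} \<Longrightarrow> norm (act (B r t) (\<psi> r t)) \<le> q"
    using bounded[OF cont_act[OF contB cont]] by blast
  have int_bound: "norm (integral {0..t} f) \<le> b * T"
    if "continuous_on {0..T} f" "\<And>s. s \<in> {0..T} \<Longrightarrow> norm (f s) \<le> b" "t \<in> {0..T}" "b \<ge> 0" for f :: "real \<Rightarrow> 'v" and b t
  proof -
    have "norm (integral {0..t} f) \<le> b * (t - 0)"
      using that by (intro integral_bound continuous_on_subset[OF that(1)]) auto
    also have "\<dots> \<le> b * T" using that by (intro mult_left_mono) auto
    finally show ?thesis .
  qed
  \<comment> \<open>The defect starts at zero because \<open>B 0 t = 0\<close> and the data at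
    \<open>r = 0\<close> are constant. \<open>E'\<close> contains an integral over \<open>t\<close>,
    hence the Gronwall bound uniform in the parameter.\<close>
  have "E r t = 0" if "r \<in> {0..1}" "t \<in> {0..T}" for r t
  proof (rule gronwall_zero[OF _ E_r _ _ that])
    show "E 0 t = 0" if "t \<in> {0..T}" for t
    proof -
      have "I 0 t = integral {0..t} (\<lambda>_. 0)"
        unfolding I_def by (rule integral_cong) (use that B0 in \<open>auto simp: act.zero_left\<close>)
      then show ?thesis using that z by (simp add: E_def \<Phi>_def init)
    qed
    show "norm (E r t) \<le> p + (p + q * T)" if r: "r \<in> {0..1}" and t: "t \<in> {0..T}" for r t
    proof -
      have "norm (I r t) \<le> q * T"
        unfolding I_def using q r t by (intro int_bound sec[OF cont_act] contB cont) auto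
      then show ?thesis unfolding E_def \<Phi>_def
        using p(2)[OF r t] p(2)[OF r z]
        by (intro order_trans[OF norm_triangle_ineq4] add_mono order_trans[OF norm_triangle_ineq]) auto
    qed
    show "norm (E' r t) \<le> (a * k + a' * k * T) * m"
      if r: "r \<in> {0..1}" and t: "t \<in> {0..T}" and m: "\<And>t. t \<in> {0..T} \<Longrightarrow> norm (E r t) \<le> m" for r t m
    proof -
      have m0: "m \<ge> 0" using m[OF t] norm_ge_zero order_trans by blast
      have act_le: "norm (act x y) \<le> b * m * k" if "norm x \<le> b" "norm y \<le> m" for x y b
        using that k(1) m0 order_trans[OF norm_ge_zero that(1)]
        by (intro order_trans[OF k(2)] mult_right_mono mult_mono) auto
      have "norm (act (A r t) (E r t)) \<le> a * m * k"
        by (intro act_le a(2) m r t)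
      moreover have "norm (integral {0..t} (\<lambda>s. act (A' r s) (E r s))) \<le> a' * m * k * T"
        using a'(1) m0 k(1)
        by (intro int_bound act_le a'(2) m r t act.continuous_on sec[OF contA'] E_sec) auto
      ultimately show ?thesis unfolding E'_def
        by (intro order_trans[OF norm_triangle_ineq4]) (simp add: algebra_simps)
    qed
  qed
  then have "\<psi> r t = \<Phi> r t" if "t \<in> {0..T}" for t
    using that r by (simp add: E_def)
  then show ?thesis
    by (rule has_vector_derivative_transform[OF t _ \<Phi>_t[OF r t]])
qed

section \<open>Spinors\<close>

text \<open>Left multiplication by the imaginary quaternion \<open>a\<^sub>1 i + a\<^sub>2 j + a\<^sub>3 k\<close>, with \<open>k\<close> acting as
  \<open>diag (-\<i>, \<i>)\<close>.\<close>
definition spin :: "real^3 \<Rightarrow> complex \<times> complex \<Rightarrow> complex \<times> complex" where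
  "spin a v = (Complex 0 (- a$3) * fst v + Complex (a$2) (a$1) * snd v,
               Complex (- a$2) (a$1) * fst v + Complex 0 (a$3) * snd v)"

lemma bounded_bilinear_spin: "bounded_bilinear spin"
  unfolding bilinear_conv_bounded_bilinear[symmetric] bilinear_def
  by (auto intro!: linearI simp: spin_def prod_eq_iff complex_eq_iff algebra_simps)

text \<open>The commutator of imaginary quaternions is twice their cross product; this turns
  flatness into an identity between vectors in \<open>real^3\<close>.\<close>

lemma spin_commutator: "spin a (spin b v) - spin b (spin a v) = 2 *\<^sub>R spin (cross3 a b) v"
  by (simp add: spin_def prod_eq_iff complex_eq_iff cross3_def vector_3 algebra_simps)

lemma norm_spin: "norm (spin a v) = norm a * norm v"
proof -
  have "(norm (spin a v))\<^sup>2 = (norm a)\<^sup>2 * (norm v)\<^sup>2"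
    unfolding power2_norm_eq_inner
    by (cases v) (simp add: spin_def inner_prod_def inner_complex_def inner_vec_def sum_3
        power2_eq_square algebra_simps)
  then show ?thesis
    by (metis norm_ge_zero power2_eq_imp_eq power_mult_distrib mult_nonneg_nonneg)
qed

text \<open>Left multiplication by an imaginary quaternion is skew, so transported spinors keep
  their norm.\<close>

lemma inner_spin_self: "spin a v \<bullet> v = 0"
  by (cases v) (simp add: spin_def inner_complex_def algebra_simps)

text \<open>Multiplication by the unit quaternion \<open>exp (- t k / 2)\<close>, which is \<open>-1\<close> at \<open>t = 2\<pi>\<close>.\<close>
definition half_rotation :: "real \<Rightarrow> complex \<times> complex \<Rightarrow> complex \<times> complex" where
  "half_rotation t v = (cis (t / 2) * fst v, cis (- t / 2) * snd v)"

lemma norm_half_rotation: "norm (half_rotation t v) = norm v"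
  by (simp add: half_rotation_def norm_prod_def norm_mult)

lemma has_vector_derivative_cis:
  "((\<lambda>t. cis (k * t)) has_vector_derivative \<i> * of_real k * cis (k * t)) (at t within S)"
proof -
  have "((\<lambda>z. exp (\<i> * of_real k * z)) has_field_derivative \<i> * of_real k * exp (\<i> * of_real k * of_real t))
      (at (of_real t))"
    by (auto intro!: derivative_eq_intros)
  from has_vector_derivative_real_field[OF this] show ?thesis
    by (simp add: cis_conv_exp mult.assoc)
qed

text \<open>A change of gauge: the half rotation commutes with multiplication by \<open>k\<close>,
  so its own derivative merely subtracts half the vertical axis from the connection.\<close>

lemma has_vector_derivative_half_rotation:
  assumes "(f has_vector_derivative spin b (f t)) (at t within S)"
  shows "((\<lambda>t. half_rotation t (f t)) has_vector_derivative
    half_rotation t (spin (b - (1/2) *\<^sub>R axis 3 1) (f t))) (at t within S)"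
proof -
  note c = has_vector_derivative_cis
  have f1: "((\<lambda>t. fst (f t)) has_vector_derivative fst (spin b (f t))) (at t within S)"
    and f2: "((\<lambda>t. snd (f t)) has_vector_derivative snd (spin b (f t))) (at t within S)"
    using assms by (auto intro: bounded_linear.has_vector_derivative bounded_linear_fst bounded_linear_snd)
  have m: "((\<lambda>t. g t * h t) has_vector_derivative g t * h' + g' * h t) (at t within S)"
    if "(g has_vector_derivative g') (at t within S)" "(h has_vector_derivative h') (at t within S)"
    for g h :: "real \<Rightarrow> complex" and g' h'
    using bounded_bilinear.has_vector_derivative[OF bounded_bilinear_mult that] .
  have "half_rotation t (spin (b - (1/2) *\<^sub>R axis 3 1) (f t)) =
      (cis (1/2 * t) * fst (spin b (f t)) + \<i> * of_real (1/2) * cis (1/2 * t) * fst (f t),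
       cis (-1/2 * t) * snd (spin b (f t)) + \<i> * of_real (-1/2) * cis (-1/2 * t) * snd (f t))"
    by (simp add: half_rotation_def spin_def axis_def complex_eq_iff field_simps)
  with has_vector_derivative_Pair[OF m[OF c[of "1/2"] f1] m[OF c[of "-1/2"] f2]]
  show ?thesis
    unfolding half_rotation_def by simp
qed

section \<open>Harmonic maps on the disk\<close>

lemma smooth_on_dir_deriv: "smooth_on S f \<Longrightarrow> smooth_on S (dir_deriv S v f)"
  unfolding smooth_on_def by (metis Ck_on.simps(2))

lemma smooth_on_imp_continuous_on: "smooth_on S f \<Longrightarrow> continuous_on S f"
  unfolding smooth_on_def by (metis Ck_on.simps(1))

lemma smooth_on_has_derivative:
  assumes "smooth_on (cball 0 1) f" "z \<in> cball 0 1"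
  shows "(f has_derivative (\<lambda>v. Re v *\<^sub>R deriv_x f z + Im v *\<^sub>R deriv_y f z)) (at z within cball 0 1)"
proof -
  let ?D = "frechet_derivative f (at z within cball 0 1)"
  have "Ck_on (Suc 0) (cball 0 1) f" using assms(1) by (simp add: smooth_on_def)
  then have D: "(f has_derivative ?D) (at z within cball 0 1)"
    using assms(2) by (auto simp: differentiable_on_def frechet_derivative_works)
  then interpret linear ?D by (rule has_derivative_linear)
  have "?D v = Re v *\<^sub>R deriv_x f z + Im v *\<^sub>R deriv_y f z" for v
  proof -
    have "?D (Re v *\<^sub>R 1 + Im v *\<^sub>R \<i>) = Re v *\<^sub>R ?D 1 + Im v *\<^sub>R ?D \<i>"
      by (simp only: add scale)
    moreover have "Re v *\<^sub>R 1 + Im v *\<^sub>R \<i> = v" by (simp add: complex_eq_iff)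
    ultimately show ?thesis by (simp add: deriv_x_def deriv_y_def dir_deriv_def)
  qed
  with D show ?thesis by (metis (no_types, lifting) ext)
qed

text \<open>On the plane orthogonal to \<open>n\<close>, \<open>cross3 n\<close> is a quarter turn,
  and rotating a plane preserves cross products of its vectors. Both sides are
  \<open>n \<bullet> cross3 a b\<close> times \<open>n\<close>.\<close>

lemma cross_cross_unit:
  fixes n a b :: "real^3"
  assumes "n \<bullet> n = 1" "n \<bullet> a = 0" "n \<bullet> b = 0"
  shows "cross3 (cross3 n a) (cross3 n b) = cross3 a b"
proof -
  have "cross3 n (cross3 a b) = 0" using assms by (simp add: Lagrange)
  then have "cross3 a b = (n \<bullet> cross3 a b) *\<^sub>R n"
    using assms(1) Lagrange[of n n "cross3 a b"] by simp
  moreover have "cross3 (cross3 n a) (cross3 n b) = (n \<bullet> cross3 a b) *\<^sub>R n"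
    by (simp add: cross3_def inner_vec_def sum_3 vec_eq_iff forall_3 vector_3 algebra_simps)
  ultimately show ?thesis by simp
qed

text \<open>Carries identities to the boundary circle from the open disk, where two-sided
  derivatives and the harmonic map equation are available.\<close>

lemma continuous_on_eq_0_closure:
  fixes f :: "complex \<Rightarrow> 'a::real_normed_vector"
  assumes "continuous_on (cball 0 1) f" "\<And>z. z \<in> ball 0 1 \<Longrightarrow> f z = 0" "z \<in> cball 0 1"
  shows "f z = 0"
  using continuous_constant_on_closure[of "ball 0 1" f 0 z] assms by simp

text \<open>Cauchy's formula at the centre: on the unit circle \<open>dw / w\<close> is
  \<open>\<i> dt\<close>, and the factor \<open>\<i>\<close> is removed at the end.\<close>

lemma has_integral_circle_mean:
  assumes "continuous_on (cball 0 1) f" "f holomorphic_on ball 0 1" "f 0 = 0"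
  shows "((\<lambda>t. f (cis t)) has_integral 0) {0..2*pi}"
proof -
  have "((\<lambda>w. f w / (w - 0)) has_contour_integral (2 * of_real pi * \<i>) * f 0) (circlepath 0 1)"
    by (rule Cauchy_integral_circlepath[OF assms(1,2)]) simp
  then have "((\<lambda>t. f (cis t) * \<i>) has_integral 0) {0..2*pi}"
    unfolding circlepath_def by (subst (asm) has_contour_integral_part_circlepath_iff) (auto simp: assms(3) )
  from has_integral_mult_left[OF this, of "-\<i>"] show ?thesis by (simp add: mult.assoc)
qed

lemma hopf_eq:
  "hopf u z = Complex ((norm (deriv_x u z))\<^sup>2 - (norm (deriv_y u z))\<^sup>2) (- 2 * (deriv_x u z \<bullet> deriv_y u z)) / 4"
  unfolding hopf_def bilinear_dot_def deriv_z_def power2_norm_eq_inner inner_vec_def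
  by (simp add: sum_3 complex_eq_iff field_simps)

section \<open>Polar derivatives on the closed disk\<close>

definition radial :: "(complex \<Rightarrow> real^3) \<Rightarrow> real \<Rightarrow> complex \<Rightarrow> real^3" where
  "radial f r p = Re p *\<^sub>R deriv_x f (of_real r * p) + Im p *\<^sub>R deriv_y f (of_real r * p)"

text \<open>This is \<open>(1/r) \<partial>f/\<partial>\<theta>\<close> at the point \<open>r p\<close>, in a form without a singularity at \<open>r = 0\<close>.\<close>
definition tangential :: "(complex \<Rightarrow> real^3) \<Rightarrow> real \<Rightarrow> complex \<Rightarrow> real^3" where
  "tangential f r p = Re p *\<^sub>R deriv_y f (of_real r * p) - Im p *\<^sub>R deriv_x f (of_real r * p)"

lemma mult_sphere_in_cball: "r \<in> {0..1} \<Longrightarrow> p \<in> sphere 0 1 \<Longrightarrow> of_real r * p \<in> cball 0 1" for p :: complex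
  by (simp add: norm_mult)

text \<open>Derivatives relative to the disk restrict to the image of the curve, so curves ending at
  the boundary circle or running along it are covered.\<close>

lemma smooth_on_chain:
  assumes "smooth_on (cball 0 1) f" "(\<gamma> has_vector_derivative \<gamma>') (at t within S)"
    and "\<gamma> ` S \<subseteq> cball 0 1" "\<gamma> t \<in> cball 0 1"
  shows "((\<lambda>t. f (\<gamma> t)) has_vector_derivative Re \<gamma>' *\<^sub>R deriv_x f (\<gamma> t) + Im \<gamma>' *\<^sub>R deriv_y f (\<gamma> t)) (at t within S)"
proof -
  have "(f has_derivative (\<lambda>v. Re v *\<^sub>R deriv_x f (\<gamma> t) + Im v *\<^sub>R deriv_y f (\<gamma> t))) (at (\<gamma> t) within \<gamma> ` S)"
    by (rule has_derivative_subset[OF smooth_on_has_derivative[OF assms(1,4)] assms(3)])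
  from has_derivative_in_compose[OF assms(2)[unfolded has_vector_derivative_def] this]
  show ?thesis by (simp add: has_vector_derivative_def scaleR_add_right)
qed

lemma has_vector_derivative_radial:
  assumes "smooth_on (cball 0 1) f" "r \<in> {0..1}" "p \<in> sphere 0 1"
  shows "((\<lambda>r. f (of_real r * p)) has_vector_derivative radial f r p) (at r within {0..1})"
proof -
  have "((\<lambda>r. of_real r * p) has_vector_derivative p) (at r within {0..1})"
    by (auto simp: has_vector_derivative_def scaleR_conv_of_real intro!: derivative_eq_intros)
  moreover have "(\<lambda>r. of_real r * p) ` {0..1} \<subseteq> cball 0 1"
    using assms(3) mult_sphere_in_cball by blast
  ultimately show ?thesis
    unfolding radial_def by (rule smooth_on_chain[OF assms(1)]) (rule mult_sphere_in_cball[OF assms(2,3)])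
qed

lemma has_vector_derivative_tangential:
  assumes "smooth_on (cball 0 1) f" "r \<in> {0..1}"
  shows "((\<lambda>t. f (of_real r * cis t)) has_vector_derivative r *\<^sub>R tangential f r (cis t)) (at t within S)"
proof -
  have "((\<lambda>t. of_real r * cis t) has_vector_derivative of_real r * (\<i> * cis t)) (at t within S)"
    using bounded_linear.has_vector_derivative[OF bounded_linear_mult_right has_vector_derivative_cis[of 1]]
    by simp
  moreover have "(\<lambda>t. of_real r * cis t) ` S \<subseteq> cball 0 1"
    using mult_sphere_in_cball[OF assms(2)] by (simp add: image_subset_iff)
  ultimately have "((\<lambda>t. f (of_real r * cis t)) has_vector_derivative
      Re (of_real r * (\<i> * cis t)) *\<^sub>R deriv_x f (of_real r * cis t)
      + Im (of_real r * (\<i> * cis t)) *\<^sub>R deriv_y f (of_real r * cis t)) (at t within S)"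
    by (rule smooth_on_chain[OF assms(1)]) (use mult_sphere_in_cball[OF assms(2), of "cis t"] in simp)
  then show ?thesis by (simp add: tangential_def algebra_simps)
qed

lemma continuous_on_polar:
  fixes f :: "complex \<Rightarrow> real^3"
  assumes "smooth_on (cball 0 1) f"
  shows "continuous_on ({0..1} \<times> sphere 0 1) (\<lambda>x. f (of_real (fst x) * snd x))"
  by (rule continuous_on_compose2[OF smooth_on_imp_continuous_on[OF assms]])
    (auto intro!: continuous_intros simp: norm_mult)

lemma smooth_on_deriv_xy:
  assumes "smooth_on (cball 0 1) f"
  shows "smooth_on (cball 0 1) (deriv_x f)" "smooth_on (cball 0 1) (deriv_y f)"
  using smooth_on_dir_deriv[OF assms] by (auto simp: deriv_x_def deriv_y_def)

lemma continuous_on_radial_tangential: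
  assumes "smooth_on (cball 0 1) f"
  shows "continuous_on ({0..1} \<times> sphere 0 1) (\<lambda>x. radial f (fst x) (snd x))"
    and "continuous_on ({0..1} \<times> sphere 0 1) (\<lambda>x. tangential f (fst x) (snd x))"
  unfolding radial_def tangential_def
  by (intro continuous_intros continuous_on_polar smooth_on_deriv_xy assms)+

lemma bounded_bilinear_cross3: "bounded_bilinear cross3"
  using bilinear_cross by (simp add: bilinear_conv_bounded_bilinear)

text \<open>Here \<open>a\<close>, \<open>b\<close> are the radial and tangential first derivatives
  of \<open>n\<close>, and \<open>p\<close>, \<open>q\<close>, \<open>w\<close> the radial,
  tangential and mixed second ones. The left side is the r-derivative of \<open>B\<close> minus the
  angular derivative of \<open>A\<close>; \<open>w\<close> cancels, and \<open>p + q\<close> is the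
  Laplacian.\<close>

lemma curvature_identity:
  fixes n a b p q w :: "real^3"
  shows "(1/2) *\<^sub>R (cross3 n (a + b) + r *\<^sub>R (cross3 a (a + b) + cross3 n (p + w)))
       - (1/2) *\<^sub>R (cross3 (r *\<^sub>R b) (a - b) + cross3 n ((b + r *\<^sub>R w) - (r *\<^sub>R q - a)))
       = r *\<^sub>R cross3 a b + (r/2) *\<^sub>R cross3 n (p + q)" (is "(1/2) *\<^sub>R ?X - (1/2) *\<^sub>R ?Y = _")
proof -
  have "?X - ?Y = (2 * r) *\<^sub>R cross3 a b + r *\<^sub>R cross3 n (p + q)"
    by (simp add: cross3_def vec_eq_iff forall_3 vector_3 algebra_simps)
  then have "(1/2) *\<^sub>R (?X - ?Y) = (1/2) *\<^sub>R ((2 * r) *\<^sub>R cross3 a b + r *\<^sub>R cross3 n (p + q))"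
    by (rule arg_cong)
  then show ?thesis
    unfolding scaleR_diff_right scaleR_add_right scaleR_scaleR by simp
qed

section \<open>Pointwise consequences of the harmonic map equation, up to the boundary\<close>

locale harmonic_disk =
  fixes u :: "complex \<Rightarrow> real^3"
  assumes smooth: "smooth_on (cball 0 1) u"
    and unit: "\<forall>z\<in>cball 0 1. u z \<in> sphere 0 1"
    and harmonic: "\<forall>z\<in>ball 0 1. - laplacian u z = grad_norm_sq u z *\<^sub>R u z"
begin

lemmas smooth_x = smooth_on_deriv_xy(1)[OF smooth]
  and smooth_y = smooth_on_deriv_xy(2)[OF smooth]

lemmas continuous_derivs = smooth_on_imp_continuous_on[OF smooth]
  smooth_on_imp_continuous_on[OF smooth_x] smooth_on_imp_continuous_on[OF smooth_y]
  smooth_on_deriv_xy[OF smooth_x, THEN smooth_on_imp_continuous_on]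
  smooth_on_deriv_xy[OF smooth_y, THEN smooth_on_imp_continuous_on]

lemma has_derivative_ball:
  assumes "smooth_on (cball 0 1) f" "z \<in> ball 0 1"
  shows "(f has_derivative (\<lambda>v. Re v *\<^sub>R deriv_x f z + Im v *\<^sub>R deriv_y f z)) (at z)"
proof -
  have "z \<in> cball 0 1" using assms(2) by auto
  moreover have "at z within cball 0 1 = at z"
    using assms(2) by (intro at_within_interior) simp
  ultimately show ?thesis
    using smooth_on_has_derivative[OF assms(1), of z] by metis
qed

lemma u_u:
  assumes "z \<in> cball 0 1"
  shows "u z \<bullet> u z = 1"
proof -
  have "norm (u z) = 1" using unit assms by fastforce
  then show ?thesis by (simp add: dot_square_norm)
qed

lemma u_perp_ball:
  assumes "z \<in> ball 0 1"
  shows "u z \<bullet> deriv_x u z = 0" "u z \<bullet> deriv_y u z = 0"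
proof -
  let ?D = "\<lambda>v. Re v *\<^sub>R deriv_x u z + Im v *\<^sub>R deriv_y u z"
  have d: "(u has_derivative ?D) (at z)" by (rule has_derivative_ball[OF smooth assms])
  have "((\<lambda>z. u z \<bullet> u z) has_derivative (\<lambda>v. u z \<bullet> ?D v + ?D v \<bullet> u z)) (at z)"
    by (rule has_derivative_inner[OF d d])
  moreover have "((\<lambda>z. u z \<bullet> u z) has_derivative (\<lambda>v. 0)) (at z)"
    by (rule has_derivative_transform_within_open[of "\<lambda>_. 1" _ _ _ "ball 0 1"])
      (use assms u_u in auto)
  ultimately have "(\<lambda>v. u z \<bullet> ?D v + ?D v \<bullet> u z) = (\<lambda>v. 0)"
    by (rule has_derivative_unique)
  from fun_cong[OF this, of 1] fun_cong[OF this, of \<i>]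
  show "u z \<bullet> deriv_x u z = 0" "u z \<bullet> deriv_y u z = 0"
    by (simp_all add: inner_commute)
qed

lemma u_perp:
  assumes "z \<in> cball 0 1"
  shows "u z \<bullet> deriv_x u z = 0" "u z \<bullet> deriv_y u z = 0"
proof -
  show "u z \<bullet> deriv_x u z = 0"
    by (rule continuous_on_eq_0_closure[where f="\<lambda>z. u z \<bullet> deriv_x u z"])
      (use assms in \<open>auto intro!: continuous_on_inner continuous_derivs simp: u_perp_ball\<close>)
  show "u z \<bullet> deriv_y u z = 0"
    by (rule continuous_on_eq_0_closure[where f="\<lambda>z. u z \<bullet> deriv_y u z"])
      (use assms in \<open>auto intro!: continuous_on_inner continuous_derivs simp: u_perp_ball\<close>)
qed

lemma mixed_ball:
  assumes "z \<in> ball 0 1"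
  shows "deriv_y (deriv_x u) z = deriv_x (deriv_y u) z"
proof (rule mixed_partials_eq[where fxy="deriv_y (deriv_x u)" and fyx="deriv_x (deriv_y u)"])
  show "continuous_on (ball 0 1) (deriv_x (deriv_y u))"
    by (rule continuous_on_subset[OF continuous_derivs(6)]) auto
  show "open (ball 0 1 :: complex set)" "z \<in> ball 0 1" by (simp_all only: open_ball assms)
qed (rule has_derivative_ball[OF smooth] has_derivative_ball[OF smooth_x] has_derivative_ball[OF smooth_y], assumption)+

lemma mixed:
  assumes "z \<in> cball 0 1"
  shows "deriv_y (deriv_x u) z = deriv_x (deriv_y u) z"
proof -
  have "deriv_y (deriv_x u) z - deriv_x (deriv_y u) z = 0"
    by (rule continuous_on_eq_0_closure[where f="\<lambda>z. deriv_y (deriv_x u) z - deriv_x (deriv_y u) z"])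
      (use assms in \<open>auto intro!: continuous_on_diff continuous_derivs simp: mixed_ball\<close>)
  then show ?thesis by simp
qed

lemma laplacian_ball:
  assumes "z \<in> ball 0 1"
  shows "deriv_x (deriv_x u) z + deriv_y (deriv_y u) z = (- grad_norm_sq u z) *\<^sub>R u z"
proof -
  have "- laplacian u z = grad_norm_sq u z *\<^sub>R u z" using harmonic assms by blast
  then have "- (- laplacian u z) = - (grad_norm_sq u z *\<^sub>R u z)" by (rule arg_cong)
  then show ?thesis by (simp add: laplacian_def add.commute)
qed

text \<open>The Laplacian is a multiple of \<open>u\<close> inside, and continuity does the rest.
  This is the conservation law for \<open>u \<times> du\<close>, the form in which harmonicity
  enters the flatness computation.\<close>

lemma u_cross_laplacian:
  assumes "z \<in> cball 0 1"
  shows "cross3 (u z) (deriv_x (deriv_x u) z + deriv_y (deriv_y u) z) = 0"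
proof (rule continuous_on_eq_0_closure[where f="\<lambda>z. cross3 (u z) (deriv_x (deriv_x u) z + deriv_y (deriv_y u) z)", OF _ _ assms])
  show "continuous_on (cball 0 1) (\<lambda>z. cross3 (u z) (deriv_x (deriv_x u) z + deriv_y (deriv_y u) z))"
    by (intro bounded_bilinear.continuous_on[OF bounded_bilinear_cross3] continuous_on_add continuous_derivs)
  fix z :: complex assume "z \<in> ball 0 1"
  from laplacian_ball[OF this] show "cross3 (u z) (deriv_x (deriv_x u) z + deriv_y (deriv_y u) z) = 0"
    by (simp add: cross_mult_right del: scaleR_minus_left)
qed

section \<open>Holomorphy of the Hopf scalar and its polar form\<close>

lemma hopf_holomorphic: "hopf u holomorphic_on ball 0 1"
proof -
  have "hopf u field_differentiable at z" if z: "z \<in> ball 0 1" for z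
  proof -
    let ?x = "deriv_x u" and ?y = "deriv_y u"
    let ?xx = "deriv_x ?x z" and ?yy = "deriv_y ?y z" and ?xy = "deriv_x ?y z"
    define X where "X = (\<lambda>v. Re v *\<^sub>R ?xx + Im v *\<^sub>R ?xy)"
    define Y where "Y = (\<lambda>v. Re v *\<^sub>R ?xy + Im v *\<^sub>R ?yy)"
    have X: "(?x has_derivative X) (at z)" and Y: "(?y has_derivative Y) (at z)"
      using has_derivative_ball[OF smooth_x z] has_derivative_ball[OF smooth_y z]
      by (simp_all add: X_def Y_def mixed_ball[OF z])
    define P where "P v = (?x z \<bullet> X v + X v \<bullet> ?x z) - (?y z \<bullet> Y v + Y v \<bullet> ?y z)" for v
    define M where "M v = ?x z \<bullet> Y v + X v \<bullet> ?y z" for v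
    have "((\<lambda>z. (of_real (?x z \<bullet> ?x z - ?y z \<bullet> ?y z) - 2 * \<i> * of_real (?x z \<bullet> ?y z)) * (1/4))
        has_derivative (\<lambda>v. (of_real (P v) - 2 * \<i> * of_real (M v)) * (1/4))) (at z)"
      unfolding P_def M_def
      by (intro has_derivative_mult_left has_derivative_diff has_derivative_mult_right
          has_derivative_of_real has_derivative_inner X Y)
    moreover have "hopf u = (\<lambda>z. (of_real (?x z \<bullet> ?x z - ?y z \<bullet> ?y z) - 2 * \<i> * of_real (?x z \<bullet> ?y z)) * (1/4))"
      by (rule ext) (simp add: hopf_eq complex_eq_iff power2_norm_eq_inner)
    \<comment> \<open>The Cauchy-Riemann equations: the Laplacian is normal to the sphere and the
      first derivatives are tangent to it, so their products vanish and the real derivative is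
      multiplication by its value at 1.\<close>
    moreover have "(of_real (P v) - 2 * \<i> * of_real (M v)) * (1/4)
        = ((of_real (P 1) - 2 * \<i> * of_real (M 1)) * (1/4)) * v" for v
    proof -
      have "(?xx + ?yy) \<bullet> ?x z = 0" "(?xx + ?yy) \<bullet> ?y z = 0"
        using u_perp_ball[OF z] by (simp_all add: laplacian_ball[OF z])
      then have "?yy \<bullet> ?x z = - (?xx \<bullet> ?x z)" "?yy \<bullet> ?y z = - (?xx \<bullet> ?y z)"
        by (simp_all add: inner_add_left add_eq_0_iff)
      then show ?thesis
        by (simp add: P_def M_def X_def Y_def complex_eq_iff inner_add_left inner_add_right
            inner_commute[of "?x z"] inner_commute[of "?y z"] algebra_simps)
    qed
    then have "(\<lambda>v. (of_real (P v) - 2 * \<i> * of_real (M v)) * (1/4)) = (*) ((of_real (P 1) - 2 * \<i> * of_real (M 1)) * (1/4))"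
      by (rule ext)
    ultimately have "(hopf u has_field_derivative (of_real (P 1) - 2 * \<i> * of_real (M 1)) * (1/4)) (at z)"
      unfolding has_field_derivative_def by (simp only:)
    then show ?thesis by (auto simp: field_differentiable_def)
  qed
  then show ?thesis
    by (auto simp: holomorphic_on_def intro: field_differentiable_at_within)
qed

lemma continuous_on_hopf: "continuous_on (cball 0 1) (hopf u)"
  unfolding hopf_eq[abs_def] Complex_eq
  by (intro continuous_intros continuous_derivs) auto

text \<open>\<open>p\<close> times \<open>deriv_z u p\<close> is half of the radial derivative minus
  \<open>\<i>\<close> times the tangential one; the right side is four times the bilinear square of
  this.\<close>

lemma hopf_polar:
  "4 * p\<^sup>2 * hopf u p = Complex ((norm (radial u 1 p))\<^sup>2 - (norm (tangential u 1 p))\<^sup>2)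
     (- 2 * (radial u 1 p \<bullet> tangential u 1 p))"
  unfolding hopf_eq radial_def tangential_def power2_norm_eq_inner
  by (simp add: complex_eq_iff power2_eq_square inner_add_left inner_add_right inner_diff_left inner_diff_right
      inner_commute[of "deriv_y u p" "deriv_x u p"] algebra_simps)

text \<open>The radial equation is solved from the centre along every ray, and flatness gives the
  angular equation on the boundary circle. The parameter is the direction \<open>p\<close> rather
  than an angle, so the section is periodic by construction.\<close>

lemma flat_section:
  obtains \<phi> where "\<phi> (2 * pi) = \<phi> 0" "\<And>t. norm (\<phi> t) = 1"
    "\<And>t. t \<in> {0..2*pi} \<Longrightarrow> (\<phi> has_vector_derivative
      spin ((1/2) *\<^sub>R cross3 (u (cis t)) (radial u 1 (cis t) + tangential u 1 (cis t))) (\<phi> t))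
      (at t within {0..2*pi})"
proof -
  let ?x = "deriv_x u" and ?y = "deriv_y u"
  define n where "n r p = u (of_real r * p)" for r :: real and p
  define A where "A r p = (1/2) *\<^sub>R cross3 (n r p) (radial u r p - tangential u r p)" for r p
  define B where "B r p = (r/2) *\<^sub>R cross3 (n r p) (radial u r p + tangential u r p)" for r p
  \<comment> \<open>Second derivatives in the moving frame: \<open>a\<close> is purely radial,
    \<open>b\<close> purely tangential, while \<open>w\<close> and \<open>w'\<close> are the mixed
    ones in the two orders, identified later by \<open>mixed\<close>.\<close>
  define a where "a r p = Re p *\<^sub>R radial ?x r p + Im p *\<^sub>R radial ?y r p" for r p
  define w where "w r p = Re p *\<^sub>R radial ?y r p - Im p *\<^sub>R radial ?x r p" for r p
  define w' where "w' r p = Re p *\<^sub>R tangential ?x r p + Im p *\<^sub>R tangential ?y r p" for r p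
  define b where "b r p = Re p *\<^sub>R tangential ?y r p - Im p *\<^sub>R tangential ?x r p" for r p
  define A' where "A' r p = (1/2) *\<^sub>R (cross3 (r *\<^sub>R tangential u r p) (radial u r p - tangential u r p)
      + cross3 (n r p) ((tangential u r p + r *\<^sub>R w' r p) - (r *\<^sub>R b r p - radial u r p)))" for r p
  define B' where "B' r p = (1/2) *\<^sub>R (cross3 (n r p) (radial u r p + tangential u r p)
      + r *\<^sub>R (cross3 (radial u r p) (radial u r p + tangential u r p)
        + cross3 (n r p) (a r p + w r p)))" for r p
  text \<open>With \<open>J = u \<times> du\<close>, the form \<open>A dr + B d\<theta>\<close> is \<open>(J + *J)/2\<close>, the member with spectral
    parameter \<open>\<i>\<close> of the associated family of flat connections of the harmonic map.\<close>
  let ?K = "{0..1} \<times> sphere (0::complex) 1"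
  note cont = continuous_on_radial_tangential[OF smooth] continuous_on_radial_tangential[OF smooth_x]
    continuous_on_radial_tangential[OF smooth_y] continuous_on_polar[OF smooth, folded n_def]
  note cont_cross = bounded_bilinear.continuous_on[OF bounded_bilinear_cross3]
  have contA: "continuous_on ?K (\<lambda>x. A (fst x) (snd x))"
    and contB: "continuous_on ?K (\<lambda>x. B (fst x) (snd x))"
    and contA': "continuous_on ?K (\<lambda>x. A' (fst x) (snd x))"
    and contB': "continuous_on ?K (\<lambda>x. B' (fst x) (snd x))"
    unfolding A_def B_def A'_def B'_def a_def b_def w_def w'_def
    by (intro cont_cross continuous_intros cont; simp)+
  have comp: "continuous_on ({0..1} \<times> {0..2*pi}) (\<lambda>x. f (fst x) (cis (snd x)))"
    if "continuous_on ?K (\<lambda>x. f (fst x) (snd x))" for f :: "real \<Rightarrow> complex \<Rightarrow> 'x::topological_space"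
    by (rule continuous_on_compose2[OF that, where f="\<lambda>x. (fst x, cis (snd x))", simplified])
      (auto intro!: continuous_intros)
  obtain \<psi> where \<psi>: "continuous_on ?K (\<lambda>(r, p). \<psi> r p)"
    "\<And>p. p \<in> sphere 0 1 \<Longrightarrow> \<psi> 0 p = (1, 0)"
    "\<And>r p. r \<in> {0..1} \<Longrightarrow> p \<in> sphere 0 1 \<Longrightarrow>
      ((\<lambda>r. \<psi> r p) has_vector_derivative spin (A r p) (\<psi> r p)) (at r within {0..1})"
    using linear_ode_with_parameter[OF bounded_bilinear_spin compact_sphere, of 0 1 A "(1, 0)"] contA
    by (auto simp: split_beta)
  have norm_\<psi>: "norm (\<psi> 1 p) = 1" if p: "p \<in> sphere 0 1" for p
  proof -
    have "((\<lambda>r. \<psi> r p \<bullet> \<psi> r p) has_vector_derivative 0) (at r within {0..1})" if "r \<in> {0..1}" for r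
      using bounded_bilinear.has_vector_derivative[OF bounded_bilinear_inner \<psi>(3)[OF that p] \<psi>(3)[OF that p]]
      by (simp add: inner_spin_self inner_commute[of "\<psi> r p"])
    then obtain c where "\<And>r. r \<in> {0..1} \<Longrightarrow> \<psi> r p \<bullet> \<psi> r p = c"
      using has_vector_derivative_zero_constant[of "{0..1}" "\<lambda>r. \<psi> r p \<bullet> \<psi> r p"] by auto
    from this[of 0] this[of 1] show ?thesis
      by (simp add: \<psi>(2)[OF p] norm_eq_sqrt_inner)
  qed
  have rad: "((\<lambda>r. radial u r p) has_vector_derivative a r p) (at r within {0..1})"
    "((\<lambda>r. tangential u r p) has_vector_derivative w r p) (at r within {0..1})"
    "((\<lambda>r. n r p) has_vector_derivative radial u r p) (at r within {0..1})"
    if "r \<in> {0..1}" "p \<in> sphere 0 1" for r p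
  proof -
    note blin = bounded_linear.has_vector_derivative[OF bounded_linear_scaleR_right]
      and x = has_vector_derivative_radial[OF smooth_x that] and y = has_vector_derivative_radial[OF smooth_y that]
    show "((\<lambda>r. radial u r p) has_vector_derivative a r p) (at r within {0..1})"
      unfolding radial_def[of u] a_def by (rule has_vector_derivative_add[OF blin[OF x] blin[OF y]])
    show "((\<lambda>r. tangential u r p) has_vector_derivative w r p) (at r within {0..1})"
      unfolding tangential_def[of u] w_def by (rule has_vector_derivative_diff[OF blin[OF y] blin[OF x]])
    show "((\<lambda>r. n r p) has_vector_derivative radial u r p) (at r within {0..1})"
      unfolding n_def by (rule has_vector_derivative_radial[OF smooth that])
  qed
  \<comment> \<open>The terms without a factor \<open>r\<close> come from the turning of the frame
    itself.\<close>
  have tan: "((\<lambda>t. radial u r (cis t)) has_vector_derivative tangential u r (cis t) + r *\<^sub>R w' r (cis t)) (at t within S)"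
    "((\<lambda>t. tangential u r (cis t)) has_vector_derivative r *\<^sub>R b r (cis t) - radial u r (cis t)) (at t within S)"
    "((\<lambda>t. n r (cis t)) has_vector_derivative r *\<^sub>R tangential u r (cis t)) (at t within S)"
    if r: "r \<in> {0..1}" for r t S
  proof -
    have c: "(cos has_field_derivative - sin t) (at t within S)" "(sin has_field_derivative cos t) (at t within S)"
      by (auto intro!: derivative_eq_intros)
    note x = has_vector_derivative_tangential[OF smooth_x r, of t S]
      and y = has_vector_derivative_tangential[OF smooth_y r, of t S]
    show "((\<lambda>t. n r (cis t)) has_vector_derivative r *\<^sub>R tangential u r (cis t)) (at t within S)"
      unfolding n_def by (rule has_vector_derivative_tangential[OF smooth r])
    show "((\<lambda>t. radial u r (cis t)) has_vector_derivative tangential u r (cis t) + r *\<^sub>R w' r (cis t)) (at t within S)"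
      using has_vector_derivative_add[OF has_vector_derivative_scaleR[OF c(1) x] has_vector_derivative_scaleR[OF c(2) y]]
      by (simp add: radial_def[of u] tangential_def[of u] w'_def algebra_simps)
    show "((\<lambda>t. tangential u r (cis t)) has_vector_derivative r *\<^sub>R b r (cis t) - radial u r (cis t)) (at t within S)"
      using has_vector_derivative_diff[OF has_vector_derivative_scaleR[OF c(1) y] has_vector_derivative_scaleR[OF c(2) x]]
      by (simp add: radial_def[of u] tangential_def[of u] b_def algebra_simps)
  qed
  note cross_deriv = bounded_bilinear.has_vector_derivative[OF bounded_bilinear_cross3]
  have A_t: "((\<lambda>t. A r (cis t)) has_vector_derivative A' r (cis t)) (at t within S)" if r: "r \<in> {0..1}" for r t S
    using bounded_linear.has_vector_derivative[OF bounded_linear_scaleR_right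
        cross_deriv[OF tan(3)[OF r] has_vector_derivative_diff[OF tan(1)[OF r] tan(2)[OF r]]], of "1/2"]
    unfolding A_def A'_def by (simp only: add.commute)
  have B_r: "((\<lambda>r. B r p) has_vector_derivative B' r p) (at r within {0..1})"
    if r: "r \<in> {0..1}" and p: "p \<in> sphere 0 1" for r p
  proof -
    have h: "((\<lambda>r. r / 2) has_field_derivative 1/2) (at r within {0..1})"
      by (auto intro!: derivative_eq_intros)
    show ?thesis
      using has_vector_derivative_scaleR[OF h cross_deriv[OF rad(3)[OF r p] has_vector_derivative_add[OF rad(1)[OF r p] rad(2)[OF r p]]]]
      unfolding B_def B'_def by (simp add: scaleR_add_right add.commute)
  qed
  have flat: "spin (B' r p) v + spin (B r p) (spin (A r p) v) = spin (A' r p) v + spin (A r p) (spin (B r p) v)"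
    if r: "r \<in> {0..1}" and p: "p \<in> sphere 0 1" for r p v
  proof -
    note z = mult_sphere_in_cball[OF r p]
    let ?a = "radial u r p" and ?b = "tangential u r p"
    have sq: "Re p * Re p + Im p * Im p = 1"
      using p by (simp add: cmod_def power2_eq_square)
    have w: "w r p = w' r p"
      unfolding w_def w'_def radial_def tangential_def using mixed[OF z] by (simp add: algebra_simps)
    \<comment> \<open>Second derivatives along the orthonormal directions \<open>p\<close> and
      \<open>\<i> p\<close> add up to the Laplacian.\<close>
    have "a r p + b r p = (Re p * Re p + Im p * Im p) *\<^sub>R (deriv_x ?x (of_real r * p) + deriv_y ?y (of_real r * p))"
      unfolding a_def b_def radial_def tangential_def using mixed[OF z] by (simp add: algebra_simps)
    then have lap: "cross3 (n r p) (a r p + b r p) = 0"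
      using u_cross_laplacian[OF z] by (simp add: sq n_def)
    have "n r p \<bullet> ?a = 0" "n r p \<bullet> ?b = 0" "n r p \<bullet> n r p = 1"
      using u_perp[OF z] u_u[OF z]
      by (simp_all add: n_def radial_def tangential_def inner_add_right inner_diff_right)
    \<comment> \<open>The outer products with \<open>n\<close> drop out, so twice the cross product
      of \<open>A\<close> and \<open>B\<close> is \<open>r *\<^sub>R cross3 ?a ?b\<close>, which is
      what remains of \<open>B' - A'\<close> once the Laplacian term is gone.\<close>
    then have "cross3 (cross3 (n r p) (?a - ?b)) (cross3 (n r p) (?a + ?b)) = cross3 (?a - ?b) (?a + ?b)"
      by (intro cross_cross_unit) (simp_all add: inner_add_right inner_diff_right)
    also have "\<dots> = 2 *\<^sub>R cross3 ?a ?b"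
      by (simp add: cross3_def vec_eq_iff forall_3 vector_3 algebra_simps)
    finally have "2 *\<^sub>R cross3 (A r p) (B r p) = r *\<^sub>R cross3 ?a ?b"
      unfolding A_def B_def by (simp add: cross_mult_left cross_mult_right)
    also have "\<dots> = B' r p - A' r p"
      using curvature_identity[of "n r p" ?a ?b r "a r p" "w r p" "b r p"] lap w
      unfolding A'_def B'_def by simp
    finally have "spin (2 *\<^sub>R cross3 (A r p) (B r p)) v = spin (B' r p - A' r p) v"
      by simp
    then have "2 *\<^sub>R spin (cross3 (A r p) (B r p)) v = spin (B' r p) v - spin (A' r p) v"
      by (simp add: bounded_bilinear.scaleR_left[OF bounded_bilinear_spin]
          bounded_bilinear.diff_left[OF bounded_bilinear_spin])
    with spin_commutator[of "A r p" "B r p" v] show ?thesis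
      by (simp add: algebra_simps)
  qed
  have "((\<lambda>t. \<psi> 1 (cis t)) has_vector_derivative spin (B 1 (cis t)) (\<psi> 1 (cis t))) (at t within {0..2*pi})"
    if "t \<in> {0..2*pi}" for t
    by (rule flat_transport[OF bounded_bilinear_spin, where A="\<lambda>r t. A r (cis t)" and B="\<lambda>r t. B r (cis t)"
          and A'="\<lambda>r t. A' r (cis t)" and B'="\<lambda>r t. B' r (cis t)" and \<psi>="\<lambda>r t. \<psi> r (cis t)" and c="(1,0)"])
      (use that \<psi> comp[OF contA] comp[OF contB] comp[OF contA'] comp[OF contB'] comp[of \<psi>] in
        \<open>auto intro!: A_t B_r flat simp: split_beta B_def[of 0]\<close>)
  then show thesis
    by (intro that[of "\<lambda>t. \<psi> 1 (cis t)"]) (auto simp: norm_\<psi> B_def n_def cis_2pi)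
qed

section \<open>The sharp length estimate on the boundary circle\<close>

definition hopf_boundary :: "complex \<Rightarrow> complex" where
  "hopf_boundary p = 4 * p\<^sup>2 * hopf u p"

lemma hopf_boundary_mean:
  "((\<lambda>t. hopf_boundary (cis t)) has_integral 0) {0..2*pi}"
    "((\<lambda>t. (hopf_boundary (cis t))\<^sup>2) has_integral 0) {0..2*pi}"
proof -
  have c: "continuous_on (cball 0 1) hopf_boundary" and h: "hopf_boundary holomorphic_on ball 0 1"
    unfolding hopf_boundary_def
    by (intro continuous_intros continuous_on_hopf holomorphic_intros hopf_holomorphic)+
  show "((\<lambda>t. hopf_boundary (cis t)) has_integral 0) {0..2*pi}"
    by (rule has_integral_circle_mean[OF c h]) (simp add: hopf_boundary_def)
  show "((\<lambda>t. (hopf_boundary (cis t))\<^sup>2) has_integral 0) {0..2*pi}"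
    by (rule has_integral_circle_mean[OF continuous_on_power[OF c] holomorphic_on_power[OF h]])
      (simp add: hopf_boundary_def)
qed

text \<open>With \<open>?w\<close> orthogonal to the unit vector \<open>u p\<close>,
  \<open>cross3 (u p) ?w\<close> has the norm of \<open>?w\<close>, and its third component is the
  product of \<open>?w\<close> with the tangential derivative. In the expanded square the mixed term
  \<open>radial u 1 p \<bullet> tangential u 1 p\<close> therefore cancels.\<close>

lemma norm_connection_shifted:
  assumes u: "u p = vector [R * Re p, R * Im p, h]" and tangential: "tangential u 1 p = vector [- R * Im p, R * Re p, 0]"
    and p: "p \<in> sphere 0 1"
  shows "4 * (norm ((1/2) *\<^sub>R cross3 (u p) (radial u 1 p + tangential u 1 p) - (1/2) *\<^sub>R axis 3 1))\<^sup>2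
    = 1 + (norm (radial u 1 p))\<^sup>2 - R\<^sup>2"
proof -
  let ?w = "radial u 1 p + tangential u 1 p"
  have z: "p \<in> cball 0 1" using p by simp
  have sq: "(Re p)\<^sup>2 + (Im p)\<^sup>2 = 1" using p by (simp add: cmod_def)
  have perp: "u p \<bullet> ?w = 0"
    using u_perp[OF z] by (simp add: radial_def tangential_def inner_add_right inner_diff_right)
  have "(norm (cross3 (u p) ?w))\<^sup>2 = ?w \<bullet> ?w"
    using norm_cross[of "u p" ?w] u_u[OF z] perp by (simp add: power2_norm_eq_inner)
  moreover have "?w \<bullet> ?w = radial u 1 p \<bullet> radial u 1 p + 2 * (radial u 1 p \<bullet> tangential u 1 p) + R\<^sup>2 * ((Re p)\<^sup>2 + (Im p)\<^sup>2)"
    by (simp add: tangential inner_vec_def sum_3 vector_3 power2_eq_square algebra_simps)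
  moreover have "cross3 (u p) ?w $ 3 = radial u 1 p \<bullet> tangential u 1 p + R\<^sup>2 * ((Re p)\<^sup>2 + (Im p)\<^sup>2)"
    by (simp add: tangential u cross3_def inner_vec_def sum_3 vector_3 power2_eq_square algebra_simps)
  moreover have "4 * (norm ((1/2) *\<^sub>R c - (1/2) *\<^sub>R axis 3 1))\<^sup>2 = (norm c)\<^sup>2 - 2 * c $ 3 + 1" for c :: "real^3"
    unfolding power2_norm_eq_inner
    by (simp add: inner_vec_def sum_3 axis_def field_simps)
  ultimately show ?thesis by (simp add: sq power2_norm_eq_inner)
qed

lemma boundary_conformal:
  assumes boundary: "\<And>t. u (cis t) = boundary_datum R t"
  shows "norm (radial u 1 (cis t)) = \<bar>R\<bar>" "norm (tangential u 1 (cis t)) = \<bar>R\<bar>"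
    "radial u 1 (cis t) \<bullet> tangential u 1 (cis t) = 0"
proof -
  let ?I = "{0..2*pi}"
  have datum: "boundary_datum R = (\<lambda>t. cos t *\<^sub>R vector [R, 0, 0] + sin t *\<^sub>R vector [0, R, 0] + vector [0, 0, sqrt (1 - R\<^sup>2)])"
    by (auto simp: boundary_datum_def vec_eq_iff forall_3 vector_3)
  have tan: "tangential u 1 (cis t) = vector [- R * sin t, R * cos t, 0]" for t
  proof -
    have "((\<lambda>t. u (cis t)) has_vector_derivative tangential u 1 (cis t)) (at t)"
      using has_vector_derivative_tangential[OF smooth, of 1 t UNIV] by simp
    moreover have "((\<lambda>t. u (cis t)) has_vector_derivative (- sin t) *\<^sub>R vector [R, 0, 0] + cos t *\<^sub>R vector [0, R, 0]) (at t)"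
      unfolding boundary datum by (auto intro!: derivative_eq_intros)
    ultimately have "tangential u 1 (cis t) = (- sin t) *\<^sub>R vector [R, 0, 0] + cos t *\<^sub>R vector [0, R, 0]"
      by (rule vector_derivative_unique_at)
    then show ?thesis by (simp add: vec_eq_iff forall_3 vector_3)
  qed
  have norm_tan: "(norm (tangential u 1 (cis t)))\<^sup>2 = R\<^sup>2" for t
  proof -
    have "(norm (tangential u 1 (cis t)))\<^sup>2 = R\<^sup>2 * (sin t)\<^sup>2 + R\<^sup>2 * (cos t)\<^sup>2"
      unfolding power2_norm_eq_inner tan by (simp add: inner_vec_def sum_3 vector_3 power2_eq_square algebra_simps)
    then show ?thesis by (simp flip: distrib_left)
  qed
  obtain \<phi> where \<phi>: "\<phi> (2 * pi) = \<phi> 0" "\<And>t. norm (\<phi> t) = 1"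
    "\<And>t. t \<in> ?I \<Longrightarrow> (\<phi> has_vector_derivative
      spin ((1/2) *\<^sub>R cross3 (u (cis t)) (radial u 1 (cis t) + tangential u 1 (cis t))) (\<phi> t)) (at t within ?I)"
    using flat_section by blast
  \<comment> \<open>The connection seen in the rotating frame; since \<open>\<phi>\<close> has norm
    1, \<open>norm (m t)\<close> is the speed of the rotated spinor.\<close>
  define m where "m t = (1/2) *\<^sub>R cross3 (u (cis t)) (radial u 1 (cis t) + tangential u 1 (cis t)) - (1/2) *\<^sub>R axis 3 1" for t
  have m: "4 * (norm (m t))\<^sup>2 = 1 + ((norm (radial u 1 (cis t)))\<^sup>2 - R\<^sup>2)" for t
    unfolding m_def using boundary tan
    by (subst norm_connection_shifted[where R=R and h="sqrt (1 - R\<^sup>2)"]) (auto simp: boundary_datum_def)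
  have cis_cont: "continuous_on ?I (\<lambda>t. (1::real, cis t))"
    by (intro continuous_intros)
  have cis_in: "(\<lambda>t. (1::real, cis t)) ` ?I \<subseteq> {0..1} \<times> sphere 0 1" by auto
  have cont_m: "continuous_on ?I m"
    using continuous_on_compose2[OF continuous_on_radial_tangential(1)[OF smooth] cis_cont cis_in]
      continuous_on_compose2[OF continuous_on_radial_tangential(2)[OF smooth] cis_cont cis_in]
      continuous_on_compose2[OF continuous_on_polar[OF smooth] cis_cont cis_in]
    unfolding m_def
    by (intro bounded_bilinear.continuous_on[OF bounded_bilinear_cross3] continuous_intros) simp_all
  have "pi \<le> integral ?I (\<lambda>t. norm (half_rotation t (spin (m t) (\<phi> t))))"
  proof (rule antipodal_path_length)
    show "((\<lambda>t. half_rotation t (\<phi> t)) has_vector_derivative half_rotation t (spin (m t) (\<phi> t))) (at t within ?I)"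
      if "t \<in> ?I" for t
      using has_vector_derivative_half_rotation[OF \<phi>(3)[OF that]] by (simp add: m_def)
    \<comment> \<open>\<open>\<phi>\<close> closes up after a full turn, whereas the half rotation
      has become -1.\<close>
    show "half_rotation (2*pi) (\<phi> (2*pi)) = - half_rotation 0 (\<phi> 0)"
      by (simp add: half_rotation_def \<phi>(1) complex_eq_iff prod_eq_iff)
  qed (use cont_m in \<open>auto simp: norm_half_rotation norm_spin \<phi>(2) intro!: continuous_intros\<close>)
  then have length: "pi \<le> integral ?I (\<lambda>t. norm (m t))"
    by (simp add: norm_half_rotation norm_spin \<phi>(2))
  have F: "hopf_boundary (cis t) = Complex ((norm (radial u 1 (cis t)))\<^sup>2 - R\<^sup>2)
      (- 2 * (radial u 1 (cis t) \<bullet> tangential u 1 (cis t)))" for t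
    unfolding hopf_boundary_def hopf_polar norm_tan ..
  have "((\<lambda>t. Re (hopf_boundary (cis t))) has_integral Re 0) ?I"
    using has_integral_linear[OF hopf_boundary_mean(1) bounded_linear_Re] by (simp add: o_def)
  then have "((\<lambda>t. (norm (radial u 1 (cis t)))\<^sup>2 - R\<^sup>2) has_integral 0) ?I"
    by (simp add: F)
  moreover have "((\<lambda>t. 2::real) has_integral 4 * pi) ?I"
    using has_integral_const_real[of "2::real" 0 "2*pi"] by simp
  \<comment> \<open>By \<open>m\<close> the first summand is
    \<open>(norm (m t))\<^sup>2 + 1/4\<close>, so the integrand is the completed square
    \<open>(norm (m t) - 1/2)\<^sup>2\<close>. The part of mean zero drops out, leaving \<pi> minus
    the length; this replaces an appeal to Cauchy-Schwarz.\<close>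
  ultimately have energy: "((\<lambda>t. 1/4 * (2 + ((norm (radial u 1 (cis t)))\<^sup>2 - R\<^sup>2)) - norm (m t)) has_integral
      1/4 * (4 * pi + 0) - integral ?I (\<lambda>t. norm (m t))) ?I"
    by (intro has_integral_diff has_integral_mult_right has_integral_add integrable_integral
        integrable_continuous_real continuous_on_norm cont_m)
  have "1/4 * (2 + ((norm (radial u 1 (cis t)))\<^sup>2 - R\<^sup>2)) - norm (m t) = (norm (m t) - 1/2)\<^sup>2" for t
    using m[of t] by (simp add: power2_eq_square algebra_simps)
  then have "((\<lambda>t. (norm (m t) - 1/2)\<^sup>2) has_integral pi - integral ?I (\<lambda>t. norm (m t))) ?I"
    using energy by simp
  moreover from this have "0 \<le> pi - integral ?I (\<lambda>t. norm (m t))"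
    by (rule has_integral_nonneg) simp
  \<comment> \<open>The integral is nonnegative, and at most 0 by \<open>length\<close>; continuity
    then makes the square vanish pointwise.\<close>
  ultimately have zero: "((\<lambda>t. (norm (m t) - 1/2)\<^sup>2) has_integral 0) (cbox 0 (2*pi))"
    using length by simp
  have nonempty: "box 0 (2 * pi) \<noteq> {}"
    using pi_gt_zero by (simp add: box_ne_empty del: pi_gt_zero)
  have "(norm (m t) - 1/2)\<^sup>2 = 0" if "t \<in> ?I" for t
    by (rule has_integral_0_cbox_imp_0[OF _ _ zero nonempty])
      (use that cont_m in \<open>auto intro!: continuous_intros\<close>)
  then have half: "norm (m t) = 1/2" if "t \<in> ?I" for t
    using that by fastforce
  have radial_I: "(norm (radial u 1 (cis t)))\<^sup>2 = R\<^sup>2" if "t \<in> ?I" for t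
    using m[of t] unfolding half[OF that] by (simp add: power_divide)
  have "((\<lambda>t. Re ((hopf_boundary (cis t))\<^sup>2)) has_integral Re 0) ?I"
    using has_integral_linear[OF hopf_boundary_mean(2) bounded_linear_Re] by (simp add: o_def)
  \<comment> \<open>On the circle \<open>hopf_boundary\<close> is now purely imaginary, so its
    square is real and nonpositive, and mean zero forces it to vanish.\<close>
  moreover have "Re ((hopf_boundary (cis t))\<^sup>2) = - (Im (hopf_boundary (cis t)))\<^sup>2" if "t \<in> ?I" for t
    unfolding F radial_I[OF that] by (simp add: power2_eq_square)
  ultimately have "((\<lambda>t. - (Im (hopf_boundary (cis t)))\<^sup>2) has_integral 0) ?I"
    using has_integral_cong[of ?I "\<lambda>t. Re ((hopf_boundary (cis t))\<^sup>2)" "\<lambda>t. - (Im (hopf_boundary (cis t)))\<^sup>2" 0]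
    by simp
  from has_integral_neg[OF this]
  have zero2: "((\<lambda>t. (Im (hopf_boundary (cis t)))\<^sup>2) has_integral 0) (cbox 0 (2*pi))"
    by simp
  have cont_F: "continuous_on ?I (\<lambda>t. hopf_boundary (cis t))"
    unfolding hopf_boundary_def
    by (intro continuous_intros continuous_on_compose2[OF continuous_on_hopf]) auto
  have "(Im (hopf_boundary (cis t)))\<^sup>2 = 0" if "t \<in> ?I" for t
    by (rule has_integral_0_cbox_imp_0[OF _ _ zero2 nonempty])
      (use that cont_F in \<open>auto intro!: continuous_intros\<close>)
  then have perp_I: "radial u 1 (cis t) \<bullet> tangential u 1 (cis t) = 0" if "t \<in> ?I" for t
    using that by (simp add: F)
  \<comment> \<open>The integral arguments cover one period; every point of the circle has an
    argument in it.\<close>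
  obtain s where s: "s \<in> ?I" "cis t = cis s"
  proof
    show "Arg2pi (cis t) \<in> ?I"
      using Arg2pi_ge_0[of "cis t"] Arg2pi_lt_2pi[of "cis t"] by simp
    show "cis t = cis (Arg2pi (cis t))"
      using Arg2pi_eq[of "cis t"] by (simp flip: cis_conv_exp)
  qed
  show "norm (radial u 1 (cis t)) = \<bar>R\<bar>" "norm (tangential u 1 (cis t)) = \<bar>R\<bar>"
    using radial_I[OF s(1)] norm_tan[of s] unfolding s(2) by (metis abs_norm_cancel real_sqrt_abs)+
  show "radial u 1 (cis t) \<bullet> tangential u 1 (cis t) = 0"
    using perp_I[OF s(1)] s(2) by simp
qed

end

theorem proposition4p1:
  fixes R :: real and u :: "complex \<Rightarrow> real^3"
  assumes "0 < R" and "R < 1"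
    and "smooth_on (cball 0 1) u"
    and "\<forall>z\<in>cball 0 1. u z \<in> sphere 0 1"
    and "\<forall>z\<in>ball 0 1. - laplacian u z = grad_norm_sq u z *\<^sub>R u z"
    and "\<forall>\<theta>. u (cis \<theta>) = boundary_datum R \<theta>"
  shows "(\<forall>\<theta>. norm (deriv_r u 1 \<theta>) = R \<and> deriv_r u 1 \<theta> \<bullet> deriv_theta u 1 \<theta> = 0)
       \<and> (\<forall>\<theta>. hopf u (cis \<theta>) = 0)"
proof -
  interpret harmonic_disk u by unfold_locales (fact assms)+
  note conformal = boundary_conformal[of R, OF assms(6)[rule_format]]
  \<comment> \<open>The radius 1 is an endpoint of \<open>{0..1}\<close>, where the one-sided
    derivative is still unique.\<close>
  have r: "deriv_r u 1 \<theta> = radial u 1 (cis \<theta>)" for \<theta>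
    unfolding deriv_r_def rcis_def
    using has_vector_derivative_radial[OF assms(3), of 1 "cis \<theta>"]
    by (intro vector_derivative_within_closed_interval) auto
  have t: "deriv_theta u 1 \<theta> = tangential u 1 (cis \<theta>)" for \<theta>
    unfolding deriv_theta_def rcis_def
    using has_vector_derivative_tangential[OF assms(3), of 1 \<theta> UNIV]
    by (intro vector_derivative_at) auto
  have "hopf u (cis \<theta>) = 0" for \<theta>
  proof -
    \<comment> \<open>Equal norms and orthogonality annihilate both components in
      \<open>hopf_polar\<close>, and the factor in front of \<open>hopf\<close> is nonzero.\<close>
    have "4 * (cis \<theta>)\<^sup>2 * hopf u (cis \<theta>) = 0"
      unfolding hopf_polar by (simp add: conformal complex_eq_iff)
    then show ?thesis by simp
  qed
  then show ?thesis
    using assms(1) by (simp add: r t conformal)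
qed

end
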